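(* Let $r\ge 2$ be an integer and let $q$ be a complex number with $0<|q|<1$. Let $\mathbf a=(a_1,\dots,a_r)\in\mathbb C^r$ satisfy $a_i-a_j\notin\mathbb Z$ for $1\le i<j\le r$, let $\mathbf b=(b_1,\dots,b_r)\in\mathbb C^r$ be arbitrary, and let $\mathbf m=(m_1,\dots,m_r)\in\mathbb Z^r$, $\mathbf n=(n_1,\dots,n_r)\in\mathbb Z^r$, $t\in\mathbb Z$. Put $$M=\sum_{i=1}^r m_i,\quad N=\sum_{i=1}^r n_i,\quad m_{\min}=\min_{1\le i\le r}m_i,\quad n_{\max}=\max_{1\le i\le r}n_i,$$ $$p=\max\{-1,\,M-N-r-t+1\},\qquad W=q^{t+r-1}\prod_{i=1}^r q^{a_i-b_i},$$ and for integers $j\ge -n_{\max}$ $$\alpha_j=\sum_{i=1}^r\frac{q^{a_i(1-t)}\prod_{l=1}^r(q^{1-b_l+a_i};q)_{m_l+j}}{(q;q)_{j+n_i}\prod_{l\ne i}(q^{a_i-a_l};q)_{n_l+j+1}}\;{}_{2r}\phi_{2r-1}\left(\begin{array}{c}q^{-j-n_i},\ (q^{b_l-a_i})_{1\le l\le r},\ (q^{a_l-a_i-n_l-j})_{l\ne i}\\ (q^{b_l-a_i-m_l-j})_{1\le l\le r},\ (q^{1-a_i+a_l})_{l\ne i}\end{array}\Big|\ q^{N-M+r-1+t}\right),$$ where every term with $j+n_i<0$ is taken to be $0$. For integers $k\geq -n_{\max}$ define $$\beta_k=\sum_{j=\max(-n_{\max},\,k-p-(t)_+-1)}^{k}(-1)^{k-j}\,\alpha_j\sum_{\substack{g+h=k-j\\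 g,h\ge 0}}\begin{bmatrix}p+1\\ h\end{bmatrix}_q\begin{bmatrix}(t)_+\\ g\end{bmatrix}_q q^{[h(h-1)+g(g-1)]/2}\,W^h .$$ Then (for all $z\neq 0$ with $|z|<1$ and $|Wz|<1$) $$\sum_{i=1}^r q^{a_i(1-t)}\frac{z^{-n_i}\prod_{l=1}^r(q^{1-b_l+a_i};q)_{m_l-n_i}}{\prod_{l\ne i}(q^{a_i-a_l};q)_{n_l-n_i+1}}\;{}_r\phi_{r-1}\left(\begin{array}{c}(q^{b_l-a_i})_{1\le l\le r}\\ (q^{1+a_l-a_i})_{l\ne i}\end{array}\Big|\ Wz\right)\;{}_r\phi_{r-1}\left(\begin{array}{c}(q^{1-b_l+a_i+m_l-n_i})_{1\le l\le r}\\ (q^{1-a_l+a_i+n_l-n_i})_{l\ne i}\end{array}\Big|\ z\right)$$ $$=\frac{1}{(Wz;q)_{p+1}\,(z;q)_{(t)_+}}\sum_{k=-n_{\max}}^{p+(t)_+-m_{\min}}\beta_k z^k .$$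
   Context: A logarithm of $q$ is fixed and $q^x=\exp(x\log q)$ for $x\in\mathbb C$. For $n\ge 1$ the $q$-shifted factorial is $(a;q)_0=1$, $(a;q)_n=\prod_{k=0}^{n-1}(1-aq^k)$, $(a;q)_{-n}=\prod_{k=1}^{n}\frac{1}{1-aq^{-k}}$. In particular $1/(q;q)_{-n}=0$ for $n\ge1$. The basic hypergeometric function (base $q$ suppressed) is $${}_r\phi_{s}\left(\begin{array}{c}c_1,\dots,c_r\\ d_1,\dots,d_s\end{array}\Big|\ z\right)=\sum_{n=0}^\infty\frac{(c_1;q)_n\cdots(c_r;q)_n}{(d_1;q)_n\cdots(d_s;q)_n(q;q)_n}\left[(-1)^nq^{n(n-1)/2}\right]^{1+s-r}z^n ,\qquad r\le s+1;$$ for $r=s+1$ the series converges for $|z|<1$, and it terminates (so is defined for all $z$) if some upper parameter is $q^{-K}$ with $K\in\{0,1,2,\dots\}$. $\begin{bmatrix}n\\ j\end{bmatrix}_q=\frac{(q;q)_n}{(q;q)_j(q;q)_{n-j}}$ is the $q$-binomial coefficient (zero for $j>n$ or $j<0$), and $(x)_+=\max(0,x)$. Empty sums are $0$ and empty products are $1$. "$l\neq i$" means $1\le l\le r$, $l\ne i$. The identity is understood for parameter values for which all expressions occurring in it are defined (no vanishing denominators). *)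

theory Defs
  imports "HOL-Analysis.Analysis"
begin

text \<open>
  A logarithm \<open>L\<close> of the base \<open>q\<close> is carried along explicitly; \<open>qexp L x\<close> is \<open>q\<close> to the
  complex power \<open>x\<close> for this choice of logarithm.
\<close>

definition qexp :: "complex \<Rightarrow> complex \<Rightarrow> complex" where
  "qexp L x = exp (x * L)"

text \<open>
  The \<open>q\<close>-shifted factorial with integer index. When a factor \<open>1 - a q\<^sup>-\<^sup>k\<close> vanishes at a negative
  index, division by zero gives the value \<open>0\<close>, whose reciprocal is again \<open>0\<close>, in accordance with
  \<open>1/(q;q)\<^sub>-\<^sub>n = 0\<close>. Hence at a negative index the value is nonzero exactly if the symbol is defined.
\<close>

definition qpoch :: "complex \<Rightarrow> complex \<Rightarrow> int \<Rightarrow> complex" where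
  "qpoch q a n =
     (if n \<ge> 0 then \<Prod>k<nat n. (1 - a * q ^ k)
      else \<Prod>k=1..nat (- n). 1 / (1 - a * q powi (- int k)))"

definition qpoch_defined :: "complex \<Rightarrow> complex \<Rightarrow> int \<Rightarrow> bool" where
  "qpoch_defined q a n \<longleftrightarrow> (\<forall>k\<in>{1..nat (- n)}. 1 - a * q powi (- int k) \<noteq> 0)"

definition qbinom :: "complex \<Rightarrow> nat \<Rightarrow> nat \<Rightarrow> complex" where
  "qbinom q n j =
     (if j \<le> n then qpoch q q (int n) / (qpoch q q (int j) * qpoch q q (int (n - j))) else 0)"

text \<open>
  The series is used for \<open>length cs \<le> length ds + 1\<close>. In a terminating series the terms after the
  last nonzero numerator are \<open>0\<close>, even if their denominators vanish.
\<close>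

definition basic_hyp :: "complex \<Rightarrow> complex list \<Rightarrow> complex list \<Rightarrow> complex \<Rightarrow> complex" where
  "basic_hyp q cs ds z =
     (\<Sum>n. (\<Prod>c\<leftarrow>cs. qpoch q c (int n)) / ((\<Prod>d\<leftarrow>ds. qpoch q d (int n)) * qpoch q q (int n))
          * ((-1) ^ n * q ^ (n * (n - 1) div 2)) ^ (1 + length ds - length cs) * z ^ n)"

definition others :: "nat \<Rightarrow> nat \<Rightarrow> nat list" where
  "others r i = filter (\<lambda>l. l \<noteq> i) [1..<r+1]"

definition W_par :: "complex \<Rightarrow> nat \<Rightarrow> (nat \<Rightarrow> complex) \<Rightarrow> (nat \<Rightarrow> complex) \<Rightarrow> int \<Rightarrow> complex" where
  "W_par L r a b t = qexp L (of_int (t + int r - 1)) * (\<Prod>i=1..r. qexp L (a i - b i))"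

definition p_par :: "nat \<Rightarrow> (nat \<Rightarrow> int) \<Rightarrow> (nat \<Rightarrow> int) \<Rightarrow> int \<Rightarrow> int" where
  "p_par r m n t = max (-1) ((\<Sum>i=1..r. m i) - (\<Sum>i=1..r. n i) - int r - t + 1)"

definition n_max :: "nat \<Rightarrow> (nat \<Rightarrow> int) \<Rightarrow> int" where
  "n_max r n = Max (n ` {1..r})"

definition m_min :: "nat \<Rightarrow> (nat \<Rightarrow> int) \<Rightarrow> int" where
  "m_min r m = Min (m ` {1..r})"

definition alpha ::
  "complex \<Rightarrow> complex \<Rightarrow> nat \<Rightarrow> (nat \<Rightarrow> complex) \<Rightarrow> (nat \<Rightarrow> complex) \<Rightarrow> (nat \<Rightarrow> int) \<Rightarrow> (nat \<Rightarrow> int) \<Rightarrow> int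
     \<Rightarrow> int \<Rightarrow> complex" where
  "alpha q L r a b m n t j =
     (\<Sum>i=1..r. if j + n i < 0 then 0 else
        qexp L (a i * (1 - of_int t)) * (\<Prod>l=1..r. qpoch q (qexp L (1 - b l + a i)) (m l + j))
        / (qpoch q q (j + n i)
             * (\<Prod>l\<in>{1..r} - {i}. qpoch q (qexp L (a i - a l)) (n l + j + 1)))
        * basic_hyp q
            (qexp L (of_int (- j - n i)) #
               map (\<lambda>l. qexp L (b l - a i)) [1..<r+1] @
               map (\<lambda>l. qexp L (a l - a i - of_int (n l) - of_int j)) (others r i))
            (map (\<lambda>l. qexp L (b l - a i - of_int (m l) - of_int j)) [1..<r+1] @
               map (\<lambda>l. qexp L (1 - a i + a l)) (others r i))
            (qexp L (of_int ((\<Sum>i=1..r. n i) - (\<Sum>i=1..r. m i) + int r - 1 + t))))"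

definition beta ::
  "complex \<Rightarrow> complex \<Rightarrow> nat \<Rightarrow> (nat \<Rightarrow> complex) \<Rightarrow> (nat \<Rightarrow> complex) \<Rightarrow> (nat \<Rightarrow> int) \<Rightarrow> (nat \<Rightarrow> int) \<Rightarrow> int
     \<Rightarrow> int \<Rightarrow> complex" where
  "beta q L r a b m n t k =
     (let p = p_par r m n t; tp = max 0 t in
      \<Sum>j = max (- n_max r n) (k - p - tp - 1)..k.
        (-1) ^ nat (k - j) * alpha q L r a b m n t j *
        (\<Sum>(g, h)\<in>{(g :: nat, h :: nat). int g + int h = k - j}.
           qbinom q (nat (p + 1)) h * qbinom q (nat tp) g
           * q ^ ((h * (h - 1) + g * (g - 1)) div 2) * W_par L r a b t ^ h))"

definition lhs ::
  "complex \<Rightarrow> complex \<Rightarrow> nat \<Rightarrow> (nat \<Rightarrow> complex) \<Rightarrow> (nat \<Rightarrow> complex) \<Rightarrow> (nat \<Rightarrow> int) \<Rightarrow> (nat \<Rightarrow> int) \<Rightarrow> int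
     \<Rightarrow> complex \<Rightarrow> complex" where
  "lhs q L r a b m n t z =
     (\<Sum>i=1..r.
        qexp L (a i * (1 - of_int t)) *
        (z powi (- n i) * (\<Prod>l=1..r. qpoch q (qexp L (1 - b l + a i)) (m l - n i))
          / (\<Prod>l\<in>{1..r} - {i}. qpoch q (qexp L (a i - a l)) (n l - n i + 1))) *
        basic_hyp q
          (map (\<lambda>l. qexp L (b l - a i)) [1..<r+1])
          (map (\<lambda>l. qexp L (1 + a l - a i)) (others r i))
          (W_par L r a b t * z) *
        basic_hyp q
          (map (\<lambda>l. qexp L (1 - b l + a i + of_int (m l) - of_int (n i))) [1..<r+1])
          (map (\<lambda>l. qexp L (1 - a l + a i + of_int (n l) - of_int (n i))) (others r i))
          z)"

text \<open>
  The condition that no denominator occurring in \<^const>\<open>lhs\<close> vanishes. It is not implied by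
  \<open>a i - a j \<notin> \<int>\<close>: the map \<^term>\<open>qexp L\<close> has period \<open>2 \<pi> \<i> / L\<close>, and a factor
  \<open>(q\<^sup>1\<^sup>-\<^sup>b\<^sup>+\<^sup>a; q)\<close> with negative index has denominators involving \<open>b\<close>.
\<close>

definition lhs_defined ::
  "complex \<Rightarrow> complex \<Rightarrow> nat \<Rightarrow> (nat \<Rightarrow> complex) \<Rightarrow> (nat \<Rightarrow> complex) \<Rightarrow> (nat \<Rightarrow> int) \<Rightarrow> (nat \<Rightarrow> int)
     \<Rightarrow> bool" where
  "lhs_defined q L r a b m n \<longleftrightarrow>
     (\<forall>i\<in>{1..r}.
        (\<forall>l\<in>{1..r}. qpoch_defined q (qexp L (1 - b l + a i)) (m l - n i)) \<and>
        (\<forall>l\<in>{1..r} - {i}.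
           qpoch q (qexp L (a i - a l)) (n l - n i + 1) \<noteq> 0 \<and>
           (\<forall>s::nat. qpoch q (qexp L (1 + a l - a i)) (int s) \<noteq> 0) \<and>
           (\<forall>s::nat. qpoch q (qexp L (1 - a l + a i + of_int (n l) - of_int (n i))) (int s) \<noteq> 0)))"

text \<open>
  The same for \<^const>\<open>alpha\<close>. Only the summands with \<open>j + n i \<ge> 0\<close> count, and their series stop
  with the term of index \<open>j + n i\<close>.
\<close>

definition alpha_defined ::
  "complex \<Rightarrow> complex \<Rightarrow> nat \<Rightarrow> (nat \<Rightarrow> complex) \<Rightarrow> (nat \<Rightarrow> complex) \<Rightarrow> (nat \<Rightarrow> int) \<Rightarrow> (nat \<Rightarrow> int)
     \<Rightarrow> int \<Rightarrow> bool" where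
  "alpha_defined q L r a b m n j \<longleftrightarrow>
     (\<forall>i\<in>{1..r}. j + n i \<ge> 0 \<longrightarrow>
        (\<forall>l\<in>{1..r}.
           qpoch_defined q (qexp L (1 - b l + a i)) (m l + j) \<and>
           (\<forall>s::nat. int s \<le> j + n i \<longrightarrow>
              qpoch q (qexp L (b l - a i - of_int (m l) - of_int j)) (int s) \<noteq> 0)) \<and>
        (\<forall>l\<in>{1..r} - {i}.
           qpoch q (qexp L (a i - a l)) (n l + j + 1) \<noteq> 0 \<and>
           (\<forall>s::nat. int s \<le> j + n i \<longrightarrow> qpoch q (qexp L (1 - a i + a l)) (int s) \<noteq> 0)))"

end

theory Submission
  imports Defs
begin

text \<open>
  Put \<open>A\<^sub>i = q\<^bsup>a\<^sub>i\<^esup>\<close> and \<open>B\<^sub>i = q\<^bsup>b\<^sub>i\<^esup>\<close>, and let \<open>c\<^sub>j\<close> be the coefficient of \<open>z\<^sup>j\<close> on the left-hand side. Once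
  \<open>m\<^sub>l + j \<ge> 0\<close> for all \<open>l\<close>, the terms of the convolution that gives \<open>c\<^sub>j\<close> are, up to a common sign, the
  residues of the rational function
  \<open>x\<^bsup>-t\<^esup> \<Prod>\<^sub>l (q x / B\<^sub>l; q)\<^bsub>m\<^sub>l + j\<^esub> / (x / A\<^sub>l; q)\<^bsub>n\<^sub>l + j + 1\<^esub>\<close> at its poles \<open>A\<^sub>i q\<^bsup>-s\<^esup>\<close>. The residue theorem
  therefore expresses \<open>c\<^sub>j\<close> by the expansions at \<open>0\<close> and \<open>\<infinity>\<close>. The expansion at \<open>0\<close> matters only for
  \<open>t > 0\<close>; its coefficient of index \<open>i\<close> is a polynomial of degree at most \<open>i\<close> in \<open>q\<^sup>j\<close>, so the residue
  is a combination of \<open>1, q\<^sup>j, \<dots>, q\<^bsup>(t-1)j\<^esup>\<close>. The expansion at \<open>\<infinity>\<close> behaves in the same way with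
  \<open>q\<^bsup>-j\<^esup>\<close> in place of \<open>q\<^sup>j\<close>, after the leading coefficient \<open>(W q\<^sup>p)\<^sup>j\<close> is split off, so that residue is a
  combination of \<open>W\<^sup>j, (W q)\<^sup>j, \<dots>, (W q\<^sup>p)\<^sup>j\<close>. Multiplication of the generating function by
  \<open>(z; q)\<^bsub>(t)\<^sub>+\<^esub> (W z; q)\<^bsub>p+1\<^esub>\<close> annihilates these exponentials, which leaves a Laurent polynomial.
  Its coefficients are the \<open>\<beta>\<^sub>k\<close>, by the finite \<open>q\<close>-binomial theorem (\<open>coeff_qprod_poly\<close>), and the
  \<open>\<alpha>\<^sub>j\<close> are the \<open>c\<^sub>j\<close>, by reversal of shifted factorials (\<open>coeff_term_reversed\<close>).

  Residues are replaced by an algebraic argument. All \<open>c\<^sub>j\<close> in a window of consecutive indices are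
  written over one common denominator, so that each is a sum of the values of a polynomial over the same
  nodes, with the same weights (\<open>coef_eq_residue_sum\<close>). By Lagrange interpolation these weights
  annihilate every power of \<open>x\<close> in a certain range of exponents (\<open>sum_residues_eq_0\<close>). The combination
  of the numerators that belongs to \<open>(z; q)\<^bsub>(t)\<^sub>+\<^esub> (W z; q)\<^bsub>p+1\<^esub>\<close> has lost its \<open>(t)\<^sub>+\<close> lowest and its
  \<open>p + 1\<close> highest coefficients (\<open>coeff_combination_eq_0\<close>), and what remains lies in that range after multiplication by \<open>x\<^bsup>-t\<^esup>\<close>.
  The highest coefficients are reduced to the lowest ones by reflection, which turns a shifted factorial
  into one with base \<open>1 / q\<close>.
\<close>

section \<open>Shifted factorials as polynomials\<close>

definition qprod_poly :: "complex \<Rightarrow> complex \<Rightarrow> nat \<Rightarrow> complex poly" where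
  "qprod_poly q c n = (\<Prod>k<n. [:1, - c * q ^ k:])"

lemma poly_qprod_poly: "poly (qprod_poly q c n) x = (\<Prod>k<n. 1 - x * c * q ^ k)"
  by (simp add: qprod_poly_def poly_prod mult_ac)

lemma qprod_poly_Suc: "qprod_poly q c (Suc n) = [:1, - c * q ^ n:] * qprod_poly q c n"
  by (simp add: qprod_poly_def mult.commute)

lemma coeff_qprod_poly_0: "coeff (qprod_poly q c n) 0 = 1"
  by (induction n) (simp_all add: qprod_poly_Suc, simp add: qprod_poly_def)

lemma degree_qprod_poly:
  assumes "q \<noteq> 0" "c \<noteq> 0"
  shows "degree (qprod_poly q c n) = n"
proof -
  have "degree (qprod_poly q c n) = (\<Sum>k<n. degree [:1, - c * q ^ k:])"
    unfolding qprod_poly_def by (rule degree_prod_eq_sum_degree) simp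
  then show ?thesis using assms by simp
qed

lemma degree_qprod_poly_le: "degree (qprod_poly q c n) \<le> n"
proof (induction n)
  case 0
  show ?case by (simp add: qprod_poly_def)
next
  case (Suc n)
  have "degree (qprod_poly q c (Suc n)) \<le> degree [:1, - c * q ^ n:] + degree (qprod_poly q c n)"
    unfolding qprod_poly_Suc by (rule degree_mult_le)
  also have "\<dots> \<le> Suc 0 + n"
    by (intro add_mono Suc) simp
  finally show ?case by simp
qed

text \<open>
  This is the comparison of coefficients in \<open>(1 - c x) (c q x; q)\<^sub>n = (c x; q)\<^sub>n (1 - c q\<^sup>n x)\<close>. The
  induction on \<open>n\<close> uses the claim for two neighbouring indices \<open>i\<close>.
\<close>

lemma coeff_qprod_poly_rec:
  "coeff (qprod_poly q c n) (Suc i) * (1 - q ^ Suc i) = c * (q ^ n - q ^ i) * coeff (qprod_poly q c n) i"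
proof (induction n arbitrary: i)
  case 0
  show ?case by (cases i) (simp_all add: qprod_poly_def coeff_eq_0)
next
  case (Suc n)
  define f where "f = coeff (qprod_poly q c n)"
  have step: "coeff (qprod_poly q c (Suc n)) (Suc k) = f (Suc k) - c * q ^ n * f k" for k
    by (simp add: qprod_poly_Suc f_def)
  show ?case
  proof (cases i)
    case 0
    have "f (Suc 0) * (1 - q) = c * (q ^ n - 1)"
      using Suc[of 0] by (simp add: f_def coeff_qprod_poly_0)
    then show ?thesis
      unfolding 0 step by (simp add: coeff_qprod_poly_0) (simp add: f_def coeff_qprod_poly_0 algebra_simps)
  next
    case (Suc h)
    have 1: "f (Suc i) * (1 - q ^ Suc i) = c * (q ^ n - q ^ i) * f i"
      and 2: "f i * (1 - q ^ i) = c * (q ^ n - q ^ h) * f h"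
      using Suc.IH[of i] Suc.IH[of h] Suc by (simp_all add: f_def)
    have "(f (Suc i) - c * q ^ n * f i) * (1 - q ^ Suc i)
        = c * (q ^ n - q ^ i) * f i - c * q ^ n * f i * (1 - q ^ Suc i)"
      using 1 by (simp add: left_diff_distrib)
    also have "\<dots> = c * (q ^ Suc n - q ^ i) * f i - c * q ^ Suc n * (f i * (1 - q ^ i))"
      by (simp add: algebra_simps)
    also have "\<dots> = c * (q ^ Suc n - q ^ i) * f i - c * q ^ Suc n * (c * (q ^ n - q ^ h) * f h)"
      by (simp only: 2)
    also have "\<dots> = c * (q ^ Suc n - q ^ i) * (f i - c * q ^ n * f h)"
      using Suc by (simp add: algebra_simps)
    finally show ?thesis using step[of i] step[of h] Suc by simp
  qed
qed

lemma qpoch_nonneg: "qpoch q a (int n) = (\<Prod>k<n. 1 - a * q ^ k)"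
  by (simp add: qpoch_def)

lemma qpoch_Suc_nat: "qpoch q a (int (Suc n)) = qpoch q a (int n) * (1 - a * q ^ n)"
  by (simp add: qpoch_nonneg del: of_nat_Suc)

lemma triangle_Suc: "Suc n * (Suc n - 1) div 2 = n * (n - 1) div 2 + n"
proof -
  have "Suc n * (Suc n - 1) = n * (n - 1) + 2 * n"
    by (cases n) auto
  then show ?thesis by simp
qed

text \<open>
  The finite \<open>q\<close>-binomial theorem: the recursion of the coefficients determines them when \<open>q\<close> is not a
  root of unity. At \<open>i = n\<close> its factor \<open>q\<^sup>n - q\<^sup>i\<close> vanishes, which cuts the coefficients off.
\<close>

lemma coeff_qprod_poly:
  assumes nru: "\<And>k. q ^ Suc k \<noteq> 1"
  shows "coeff (qprod_poly q c n) i = (-1) ^ i * qbinom q n i * q ^ (i * (i - 1) div 2) * c ^ i"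
proof (induction i)
  have nz: "qpoch q q (int k) \<noteq> 0" for k
    using nru by (auto simp: qpoch_nonneg)
  {
    case 0
    show ?case using nz by (simp add: coeff_qprod_poly_0 qbinom_def) (simp add: qpoch_def)
  next
    case (Suc i)
    have ne: "1 - q ^ Suc i \<noteq> 0" using nru[of i] by simp
    have "coeff (qprod_poly q c n) (Suc i) * (1 - q ^ Suc i)
        = c * (q ^ n - q ^ i) * ((-1) ^ i * qbinom q n i * q ^ (i * (i - 1) div 2) * c ^ i)"
      using coeff_qprod_poly_rec[of q c n i] Suc by simp
    moreover have "qbinom q n (Suc i) * (1 - q ^ Suc i) * q ^ i = - (q ^ n - q ^ i) * qbinom q n i"
    proof (cases "Suc i \<le> n")
      case True
      then obtain d where d: "n = Suc i + d" using le_Suc_ex by blast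
      have ne': "1 - q ^ Suc d \<noteq> 0" using nru[of d] by simp
      have s1: "qpoch q q (int (Suc i)) = qpoch q q (int i) * (1 - q ^ Suc i)"
        and s2: "qpoch q q (int (Suc d)) = qpoch q q (int d) * (1 - q ^ Suc d)"
        by (simp_all only: qpoch_Suc_nat power_Suc)
      have "qbinom q n (Suc i) * (1 - q ^ Suc i) = qpoch q q (int n) / (qpoch q q (int i) * qpoch q q (int d))"
        using d ne nz[of i] nz[of d] unfolding qbinom_def by (simp del: of_nat_Suc power_Suc add: s1)
      moreover have "qbinom q n i * (1 - q ^ Suc d) = qpoch q q (int n) / (qpoch q q (int i) * qpoch q q (int d))"
      proof -
        have "n - i = Suc d" using d by simp
        then show ?thesis
          using d ne' nz[of i] nz[of d] unfolding qbinom_def by (simp del: of_nat_Suc power_Suc add: s2)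
      qed
      moreover have "- (q ^ n - q ^ i) = q ^ i * (1 - q ^ Suc d)"
        using d by (simp add: power_add algebra_simps)
      ultimately show ?thesis by (simp add: mult_ac)
    next
      case False
      then show ?thesis by (cases "i = n") (simp_all add: qbinom_def)
    qed
    moreover have key: "e = ((-1) * (-1) ^ i) * B * (Q * X) * (c * C) * P"
      if "e = c * D * ((-1) ^ i * b * X * C)" "B * P * Q = - D * b"
      for e B Q X C P D b :: complex
    proof -
      have "e = (-1) ^ i * X * C * c * (D * b)" using that(1) by (simp add: mult_ac)
      also have "D * b = - (B * P * Q)" using that(2) by simp
      finally show ?thesis by (simp add: mult_ac)
    qed
    ultimately have "coeff (qprod_poly q c n) (Suc i) * (1 - q ^ Suc i)
        = (-1) ^ Suc i * qbinom q n (Suc i) * (q ^ i * q ^ (i * (i - 1) div 2)) * c ^ Suc i * (1 - q ^ Suc i)"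
      by (simp only: power_Suc)
    then have "coeff (qprod_poly q c n) (Suc i)
        = (-1) ^ Suc i * qbinom q n (Suc i) * (q ^ i * q ^ (i * (i - 1) div 2)) * c ^ Suc i"
      using mult_right_cancel[OF ne] by blast
    then show ?case unfolding triangle_Suc power_add by (simp only: mult_ac)
  }
qed

text \<open>
  Each step of the recursion contributes one factor that is linear in \<open>q\<^sup>n\<close>; the polynomial \<open>p\<close> is the
  same for all lengths \<open>n\<close>.
\<close>

lemma coeff_qprod_poly_is_poly:
  assumes nru: "\<And>k. q ^ Suc k \<noteq> 1"
  shows "\<exists>p. degree p \<le> i \<and> (\<forall>n. coeff (qprod_poly q c n) i = poly p (q ^ n))"
proof (induction i)
  case 0
  show ?case by (rule exI[of _ 1]) (simp add: coeff_qprod_poly_0)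
next
  case (Suc i)
  then obtain p where p: "degree p \<le> i" "\<And>n. coeff (qprod_poly q c n) i = poly p (q ^ n)" by blast
  let ?p = "smult (c / (1 - q ^ Suc i)) ([:- (q ^ i), 1:] * p)"
  have "degree ?p \<le> degree ([:- (q ^ i), 1:] * p)" by (rule degree_smult_le)
  also have "\<dots> \<le> degree [:- (q ^ i), 1:] + degree p" by (rule degree_mult_le)
  also have "\<dots> \<le> Suc i" using p by simp
  finally have "degree ?p \<le> Suc i" .
  moreover have "coeff (qprod_poly q c n) (Suc i) = poly ?p (q ^ n)" for n
    using coeff_qprod_poly_rec[of q c n i] nru[of i] p(2)[of n]
    by (simp add: field_simps)
  ultimately show ?case by blast
qed

text \<open>
  Reflection exchanges the expansions at \<open>0\<close> and at \<open>\<infinity>\<close>. The class of shifted factorials is closed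
  under it, so whatever holds for low coefficients can be transferred to high ones.
\<close>

lemma reflect_qprod_poly:
  assumes "q \<noteq> 0" "c \<noteq> 0"
  shows "reflect_poly (qprod_poly q c n) = smult (\<Prod>k<n. - c * q ^ k) (qprod_poly (1 / q) (1 / c) n)"
proof -
  have "reflect_poly [:1, - c * q ^ k:] = smult (- c * q ^ k) [:1, - (1 / c) * (1 / q) ^ k:]" for k
    using assms by (simp add: reflect_poly_pCons field_simps monom_altdef)
  then show ?thesis
    unfolding qprod_poly_def reflect_poly_prod by (simp only: prod_smult)
qed

section \<open>Families with exponential coefficients and their recurrences\<close>

text \<open>
  The index \<open>d\<close> enters the coefficient of \<open>x\<^sup>i\<close> only through the exponentials \<open>Q\<^bsup>c d\<^esup>\<close> with
  \<open>0 \<le> c \<le> i\<close>. The bound by \<open>i\<close> is additive under convolution, which makes the property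
  multiplicative.
\<close>

definition graded_family :: "complex \<Rightarrow> nat set \<Rightarrow> (nat \<Rightarrow> complex poly) \<Rightarrow> bool" where
  "graded_family Q D f \<longleftrightarrow> (\<forall>i. \<exists>p. degree p \<le> i \<and> (\<forall>d\<in>D. coeff (f d) i = poly p (Q ^ d)))"

lemma graded_family_mult:
  assumes "graded_family Q D f" "graded_family Q D g"
  shows "graded_family Q D (\<lambda>d. f d * g d)"
proof -
  obtain p where p: "\<And>i. degree (p i) \<le> i" "\<And>i d. d \<in> D \<Longrightarrow> coeff (f d) i = poly (p i) (Q ^ d)"
    using assms(1) unfolding graded_family_def by metis
  obtain p' where p': "\<And>i. degree (p' i) \<le> i" "\<And>i d. d \<in> D \<Longrightarrow> coeff (g d) i = poly (p' i) (Q ^ d)"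
    using assms(2) unfolding graded_family_def by metis
  show ?thesis
    unfolding graded_family_def
  proof
    fix i
    have "degree (\<Sum>k\<le>i. p k * p' (i - k)) \<le> i"
    proof (rule degree_sum_le)
      fix k assume "k \<in> {..i}"
      have "degree (p k * p' (i - k)) \<le> degree (p k) + degree (p' (i - k))" by (rule degree_mult_le)
      also have "\<dots> \<le> k + (i - k)" by (intro add_mono p p')
      finally show "degree (p k * p' (i - k)) \<le> i" using \<open>k \<in> {..i}\<close> by simp
    qed simp
    then show "\<exists>P. degree P \<le> i \<and> (\<forall>d\<in>D. coeff (f d * g d) i = poly P (Q ^ d))"
      by (intro exI[of _ "\<Sum>k\<le>i. p k * p' (i - k)"]) (simp add: coeff_mult poly_sum p p')
  qed
qed

lemma graded_family_1: "graded_family Q D (\<lambda>d. 1)"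
  unfolding graded_family_def
proof
  fix i :: nat
  show "\<exists>p. degree p \<le> i \<and> (\<forall>d\<in>D. coeff 1 i = poly p (Q ^ d))"
    by (rule exI[of _ "if i = 0 then 1 else 0"]) auto
qed

lemma graded_family_prod:
  assumes "\<And>l. l \<in> I \<Longrightarrow> graded_family Q D (f l)"
  shows "graded_family Q D (\<lambda>d. \<Prod>l\<in>I. f l d)"
  using assms
  by (induction I rule: infinite_finite_induct) (simp_all add: graded_family_1 graded_family_mult)

text \<open>
  The length \<open>N d\<close> may increase or decrease with \<open>d\<close>: a length \<open>\<kappa> - d\<close> with base \<open>1 / q\<close> depends on
  \<open>q\<^sup>d\<close> just as a length \<open>\<mu> + d\<close> with base \<open>q\<close> does.
\<close>

lemma graded_family_qprod_poly:
  assumes nru: "\<And>k. q ^ Suc k \<noteq> 1"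
    and pow: "\<And>d. d \<in> D \<Longrightarrow> q ^ N d = y * Q ^ d"
  shows "graded_family Q D (\<lambda>d. qprod_poly q c (N d))"
  unfolding graded_family_def
proof
  fix i
  obtain p where p: "degree p \<le> i" "\<And>n. coeff (qprod_poly q c n) i = poly p (q ^ n)"
    using coeff_qprod_poly_is_poly[OF nru] by blast
  have "degree (p \<circ>\<^sub>p [:0, y:]) \<le> i"
    using p(1) by (simp add: degree_pcompose)
  moreover have "\<forall>d\<in>D. coeff (qprod_poly q c (N d)) i = poly (p \<circ>\<^sub>p [:0, y:]) (Q ^ d)"
    by (simp add: p(2) pow poly_pcompose mult.commute)
  ultimately show "\<exists>p. degree p \<le> i \<and> (\<forall>d\<in>D. coeff (qprod_poly q c (N d)) i = poly p (Q ^ d))"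
    by blast
qed

lemma sum_coeff_rev_power:
  fixes E :: "complex poly"
  assumes "degree E \<le> T" "x * y = 1"
  shows "(\<Sum>d\<le>T. coeff E (T - d) * x ^ d) = x ^ T * poly E y"
proof -
  have "(\<Sum>d\<le>T. coeff E (T - d) * x ^ d) = (\<Sum>d\<le>T. coeff E d * x ^ (T - d))"
    by (subst sum.nat_diff_reindex[of _ "Suc T", unfolded lessThan_Suc_atMost, symmetric]) simp
  also have "\<dots> = (\<Sum>d\<le>T. x ^ T * (coeff E d * y ^ d))"
  proof (rule sum.cong)
    fix d assume "d \<in> {..T}"
    then have "x ^ T * y ^ d = x ^ (T - d) * (x * y) ^ d"
      by (simp add: power_mult_distrib power_add[symmetric] flip: mult.assoc)
    then show "coeff E d * x ^ (T - d) = x ^ T * (coeff E d * y ^ d)" using assms by simp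
  qed simp
  also have "\<dots> = x ^ T * (\<Sum>d\<le>T. coeff E d * y ^ d)" by (simp add: sum_distrib_left)
  also have "(\<Sum>d\<le>T. coeff E d * y ^ d) = poly E y"
    unfolding poly_altdef using assms(1)
    by (intro sum.mono_neutral_right) (auto simp: coeff_eq_0)
  finally show ?thesis .
qed

text \<open>
  A linear recurrence with characteristic polynomial \<open>E\<close> annihilates an exponential sequence whose
  reciprocal base is a root of \<open>E\<close>; here all the exponentials in \<open>w\<^sup>d p(Q\<^sup>d)\<close> have this property.
\<close>

lemma annihilate_exponential_sum:
  fixes E p :: "complex poly"
  assumes "degree E \<le> T"
    and "\<And>c. c \<le> degree p \<Longrightarrow> \<exists>y. w * Q ^ c * y = 1 \<and> poly E y = 0"
  shows "(\<Sum>d\<le>T. coeff E (T - d) * (w ^ d * poly p (Q ^ d))) = 0"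
proof -
  have "(\<Sum>d\<le>T. coeff E (T - d) * (w ^ d * poly p (Q ^ d)))
      = (\<Sum>d\<le>T. \<Sum>c\<le>degree p. coeff p c * (coeff E (T - d) * (w * Q ^ c) ^ d))"
    by (simp add: poly_altdef sum_distrib_left power_mult_distrib mult_ac flip: power_mult)
  also have "\<dots> = (\<Sum>c\<le>degree p. coeff p c * (\<Sum>d\<le>T. coeff E (T - d) * (w * Q ^ c) ^ d))"
    by (subst sum.swap) (simp add: sum_distrib_left)
  also have "\<dots> = 0"
  proof (rule sum.neutral, rule ballI)
    fix c assume "c \<in> {..degree p}"
    then obtain y where "w * Q ^ c * y = 1" "poly E y = 0" using assms(2) by auto
    then have "(\<Sum>d\<le>T. coeff E (T - d) * (w * Q ^ c) ^ d) = 0"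
      using sum_coeff_rev_power[OF assms(1)] by simp
    then show "coeff p c * (\<Sum>d\<le>T. coeff E (T - d) * (w * Q ^ c) ^ d) = 0" by simp
  qed
  finally show ?thesis .
qed

section \<open>Vanishing sums over the nodes of Lagrange interpolation\<close>

text \<open>
  The interpolation polynomial of \<open>x\<^sup>k\<close> at the nodes is \<open>x\<^sup>k\<close> itself, and its coefficient at the highest
  possible power \<open>card S - 1 > k\<close> is the sum in question.
\<close>

lemma sum_Lagrange_weights_eq_0:
  fixes x :: "'a \<Rightarrow> complex"
  assumes fin: "finite S" and inj: "inj_on x S" and k: "k + 2 \<le> card S"
  shows "(\<Sum>a\<in>S. x a ^ k / (\<Prod>b\<in>S-{a}. x a - x b)) = 0"
proof -
  define w where "w a = x a ^ k / (\<Prod>b\<in>S-{a}. x a - x b)" for a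
  define P where "P a = (\<Prod>b\<in>S-{a}. [:- x b, 1:])" for a
  define F where "F = (\<Sum>a\<in>S. smult (w a) (P a))"
  have degP: "degree (P a) = card S - 1" if "a \<in> S" for a
    unfolding P_def using that fin by (subst degree_prod_eq_sum_degree) auto
  have leadP: "coeff (P a) (card S - 1) = 1" if "a \<in> S" for a
    using lead_coeff_prod[of "\<lambda>b. [:- x b, 1:]" "S - {a}"] degP[OF that] by (simp add: P_def)
  have "F = monom 1 k"
  proof (rule poly_eqI_degree[where A = "x ` S"])
    fix y assume "y \<in> x ` S"
    then obtain a where a: "a \<in> S" "y = x a" by auto
    have "poly (P b) y = 0" if "b \<in> S - {a}" for b
      unfolding P_def poly_prod using that a fin by (intro prod_zero) auto
    then have "poly F y = w a * poly (P a) y"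
      unfolding F_def using a fin by (simp add: poly_sum sum.remove[of S a])
    also have "\<dots> = x a ^ k"
    proof -
      have "(\<Prod>b\<in>S-{a}. x a - x b) \<noteq> 0"
        using fin inj a by (auto simp: inj_on_def)
      then show ?thesis by (simp add: w_def P_def poly_prod a)
    qed
    finally show "poly F y = poly (monom 1 k) y" using a by (simp add: poly_monom)
  next
    have "degree F \<le> card S - 1"
      unfolding F_def using fin degP by (intro degree_sum_le) (auto intro: order.trans[OF degree_smult_le])
    then show "degree F < card (x ` S)" using k inj by (simp add: card_image)
  next
    show "degree (monom 1 k :: complex poly) < card (x ` S)"
      using k inj by (simp add: card_image degree_monom_eq)
  qed
  then have "coeff F (card S - 1) = 0" using k by simp
  then show ?thesis using leadP by (simp add: F_def coeff_sum w_def)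
qed

text \<open>
  The same sum for the denominator \<open>\<Prod> (1 - y / x\<^sub>b)\<close>, which is normalised at \<open>0\<close> instead of \<open>\<infinity>\<close>. The
  change of normalisation divides the weight of the node \<open>x\<^sub>a\<close> by \<open>x\<^sub>a\<close>, up to a common factor; hence
  the exponent \<open>k + 1\<close>.
\<close>

lemma sum_residues_eq_0:
  fixes x :: "'a \<Rightarrow> complex"
  assumes fin: "finite S" and inj: "inj_on x S" and nz: "\<And>a. a \<in> S \<Longrightarrow> x a \<noteq> 0"
    and k: "0 \<le> k" "k + 2 \<le> int (card S)"
  shows "(\<Sum>a\<in>S. x a powi (k + 1) / (\<Prod>b\<in>S-{a}. 1 - x a / x b)) = 0"
proof -
  define C where "C = (\<Prod>b\<in>S. - x b)"
  have C: "C \<noteq> 0" using nz fin by (auto simp: C_def)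
  have eq: "x a powi (k + 1) / (\<Prod>b\<in>S-{a}. 1 - x a / x b)
      = - C * (x a ^ nat k / (\<Prod>b\<in>S-{a}. x a - x b))" if a: "a \<in> S" for a
  proof -
    have "1 - x a / x b = (x a - x b) / (- x b)" if "b \<in> S - {a}" for b
      using nz that by (simp add: field_simps)
    then have "(\<Prod>b\<in>S-{a}. 1 - x a / x b) = (\<Prod>b\<in>S-{a}. x a - x b) / (\<Prod>b\<in>S-{a}. - x b)"
      by (simp only: prod_dividef[symmetric] cong: prod.cong)
    moreover have "C = - x a * (\<Prod>b\<in>S-{a}. - x b)"
      unfolding C_def using a fin by (simp add: prod.remove)
    moreover have "x a powi (k + 1) = x a * x a ^ nat k"
      using k nz[OF a] by (simp add: power_int_def nat_add_distrib)
    ultimately show ?thesis by simp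
  qed
  have "(\<Sum>a\<in>S. x a powi (k + 1) / (\<Prod>b\<in>S-{a}. 1 - x a / x b))
      = - C * (\<Sum>a\<in>S. x a ^ nat k / (\<Prod>b\<in>S-{a}. x a - x b))"
    using eq by (simp add: sum_distrib_left)
  also have "\<dots> = 0"
    using sum_Lagrange_weights_eq_0[OF fin inj, of "nat k"] k by simp
  finally show ?thesis .
qed

section \<open>Numerators over a common denominator\<close>

text \<open>
  For the exponent \<open>j\<^sub>0 + d\<close> of \<open>z\<close>, the first factor is the numerator of the rational function, of length
  \<open>\<mu>\<^sub>l + d\<close>. The second one consists of the factors that the common denominator has in excess of the
  denominator belonging to \<open>j\<^sub>0 + d\<close>. They are numbered from the far end: there the starting point
  \<open>w\<^sub>l\<close> is independent of \<open>d\<close>, at the price of the base \<open>1 / q\<close>.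
\<close>

definition numer_poly ::
  "complex \<Rightarrow> 'i set \<Rightarrow> ('i \<Rightarrow> complex) \<Rightarrow> ('i \<Rightarrow> complex) \<Rightarrow> ('i \<Rightarrow> nat) \<Rightarrow> nat \<Rightarrow> nat \<Rightarrow> complex poly" where
  "numer_poly q I u w \<mu> \<kappa> d =
     (\<Prod>l\<in>I. qprod_poly q (u l) (\<mu> l + d) * qprod_poly (1 / q) (w l) (\<kappa> - d))"

lemma inverse_not_root_of_unity:
  fixes q :: complex
  assumes "q ^ Suc k \<noteq> 1"
  shows "(1 / q) ^ Suc k \<noteq> 1"
  using assms unfolding power_one_over by (metis div_by_1 divide_divide_eq_right mult_1 div_by_0 zero_neq_one)

lemma graded_family_numer_poly:
  assumes q: "q \<noteq> 0" and nru: "\<And>k. q ^ Suc k \<noteq> 1"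
  shows "graded_family q {..\<kappa>} (numer_poly q I u w \<mu> \<kappa>)"
  unfolding numer_poly_def
proof (intro graded_family_prod graded_family_mult)
  fix l
  show "graded_family q {..\<kappa>} (\<lambda>d. qprod_poly q (u l) (\<mu> l + d))"
    by (rule graded_family_qprod_poly[where y = "q ^ \<mu> l"]) (auto simp: nru power_add simp del: power_Suc)
  have "(1 / q) ^ (\<kappa> - d) = (1 / q) ^ \<kappa> * q ^ d" if "d \<in> {..\<kappa>}" for d
    using that q by (simp add: power_diff power_one_over)
  then show "graded_family q {..\<kappa>} (\<lambda>d. qprod_poly (1 / q) (w l) (\<kappa> - d))"
    using inverse_not_root_of_unity[OF nru] by (intro graded_family_qprod_poly[where y = "(1 / q) ^ \<kappa>"])
qed

lemma degree_numer_poly: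
  assumes "q \<noteq> 0" "\<And>l. l \<in> I \<Longrightarrow> u l \<noteq> 0" "\<And>l. l \<in> I \<Longrightarrow> w l \<noteq> 0" "d \<le> \<kappa>"
  shows "degree (numer_poly q I u w \<mu> \<kappa> d) = (\<Sum>l\<in>I. \<mu> l + \<kappa>)"
proof -
  have nz: "qprod_poly q' c n \<noteq> 0" for q' c n
    using coeff_qprod_poly_0[of q' c n] by auto
  show ?thesis
    unfolding numer_poly_def using assms nz
    by (subst degree_prod_eq_sum_degree) (auto simp: degree_mult_eq degree_qprod_poly intro!: sum.cong)
qed

text \<open>
  The constant split off by the reflection is the leading coefficient. From \<open>d\<close> to \<open>d + 1\<close> it gains the
  factors \<open>- u\<^sub>l q\<^bsup>\<mu>\<^sub>l + d\<^esup>\<close> and loses \<open>- w\<^sub>l q\<^bsup>-(\<kappa> - d - 1)\<^esup>\<close>. The powers of \<open>q\<close> that depend on \<open>d\<close>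
  cancel in the quotient, so the leading coefficient is a geometric sequence in \<open>d\<close>.
\<close>

lemma reflect_numer_poly:
  assumes q: "q \<noteq> 0" and u: "\<And>l. l \<in> I \<Longrightarrow> u l \<noteq> 0" and w: "\<And>l. l \<in> I \<Longrightarrow> w l \<noteq> 0"
  shows "\<exists>h. \<forall>d\<le>\<kappa>. reflect_poly (numer_poly q I u w \<mu> \<kappa> d)
     = smult (h * (\<Prod>l\<in>I. u l * q ^ (\<mu> l + \<kappa>) / (q * w l)) ^ d)
         (numer_poly (1 / q) I (\<lambda>l. 1 / u l) (\<lambda>l. 1 / w l) \<mu> \<kappa> d)"
proof -
  define H where
    "H d = (\<Prod>l\<in>I. (\<Prod>k<\<mu> l + d. - u l * q ^ k) * (\<Prod>k<\<kappa> - d. - w l * (1 / q) ^ k))" for d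
  define om where "om = (\<Prod>l\<in>I. u l * q ^ (\<mu> l + \<kappa>) / (q * w l))"
  have refl: "reflect_poly (numer_poly q I u w \<mu> \<kappa> d)
      = smult (H d) (numer_poly (1 / q) I (\<lambda>l. 1 / u l) (\<lambda>l. 1 / w l) \<mu> \<kappa> d)" for d
  proof -
    have "reflect_poly (qprod_poly q (u l) (\<mu> l + d) * qprod_poly (1 / q) (w l) (\<kappa> - d))
       = smult ((\<Prod>k<\<mu> l + d. - u l * q ^ k) * (\<Prod>k<\<kappa> - d. - w l * (1 / q) ^ k))
           (qprod_poly (1 / q) (1 / u l) (\<mu> l + d) * qprod_poly (1 / (1 / q)) (1 / w l) (\<kappa> - d))"
      if "l \<in> I" for l
      using q u[OF that] w[OF that] by (simp only: reflect_poly_mult)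
        (subst (1 2) reflect_qprod_poly; simp add: mult_ac)
    then show ?thesis
      unfolding numer_poly_def reflect_poly_prod H_def by (simp only: prod_smult cong: prod.cong)
  qed
  have H: "H d = H 0 * om ^ d" if "d \<le> \<kappa>" for d
    using that
  proof (induction d)
    case (Suc d)
    have "(\<Prod>k<\<mu> l + Suc d. - u l * q ^ k) * (\<Prod>k<\<kappa> - Suc d. - w l * (1 / q) ^ k)
        = ((\<Prod>k<\<mu> l + d. - u l * q ^ k) * (\<Prod>k<\<kappa> - d. - w l * (1 / q) ^ k))
            * (u l * q ^ (\<mu> l + \<kappa>) / (q * w l))" if l: "l \<in> I" for l
    proof -
      obtain e where e: "\<kappa> = Suc (d + e)" using Suc.prems by (metis add_Suc less_eqE)
      have e1: "\<kappa> - d = Suc e" "\<kappa> - Suc d = e" using e by auto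
      have e2: "q ^ (\<mu> l + \<kappa>) = q * q ^ e * q ^ (\<mu> l + d)" using e by (simp add: power_add)
      have e3: "(- w l * (1 / q) ^ e) * (u l * (q * q ^ e * q ^ (\<mu> l + d)) / (q * w l))
          = - u l * q ^ (\<mu> l + d)"
        using q w[OF l] by (simp add: power_one_over)
      have "PA * a * PB = PA * (PB * b) * c" if "b * c = a" for PA PB a b c :: complex
        unfolding that[symmetric] by (simp only: mult_ac)
      from this[OF e3] show ?thesis by (simp only: prod.lessThan_Suc add_Suc_right e1 e2)
    qed
    then have "H (Suc d) = H d * om"
      unfolding H_def om_def prod.distrib[symmetric] by (simp only: cong: prod.cong)
    then show ?case using Suc by simp
  qed simp
  show ?thesis
    unfolding om_def[symmetric]
  proof (intro exI allI impI)
    fix d assume "d \<le> \<kappa>"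
    then show "reflect_poly (numer_poly q I u w \<mu> \<kappa> d) = smult (H 0 * om ^ d)
        (numer_poly (1 / q) I (\<lambda>l. 1 / u l) (\<lambda>l. 1 / w l) \<mu> \<kappa> d)"
      by (simp only: refl H[symmetric])
  qed
qed

lemma degree_mult_qprod_poly_le: "degree (qprod_poly q c k * qprod_poly q c' k') \<le> k + k'"
  using degree_mult_le[of "qprod_poly q c k" "qprod_poly q c' k'"]
    degree_qprod_poly_le[of q c k] degree_qprod_poly_le[of q c' k'] by linarith

lemma poly_qprod_poly_eq_0:
  assumes "k < n" "x * c * q ^ k = 1"
  shows "poly (qprod_poly q c n) x = 0"
  unfolding poly_qprod_poly using assms by (intro prod_zero) auto

text \<open>
  The factor \<open>(z; q)\<close> of \<open>E\<close> removes the \<open>T0\<close> lowest coefficients, whose exponentials are \<open>q\<^bsup>c d\<^esup>\<close> with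
  \<open>c < T0\<close>. The factor \<open>(W z; q)\<close> removes the \<open>P\<close> highest ones: by reflection, their exponentials are
  \<open>(W q\<^bsup>P-1\<^esup> q\<^bsup>-c\<^esup>)\<^sup>d\<close> with \<open>c < P\<close>. The assumption on \<open>W\<close> identifies \<open>W q\<^bsup>P-1\<^esup>\<close> as the ratio of successive
  leading coefficients.
\<close>

lemma coeff_combination_eq_0:
  fixes q W :: complex and P T0 \<kappa> :: nat
  defines "E \<equiv> qprod_poly q W P * qprod_poly q 1 T0"
  assumes q: "q \<noteq> 0" and nru: "\<And>k. q ^ Suc k \<noteq> 1"
    and u: "\<And>l. l \<in> I \<Longrightarrow> u l \<noteq> 0" and w: "\<And>l. l \<in> I \<Longrightarrow> w l \<noteq> 0" and I: "finite I"
    and \<kappa>: "P + T0 \<le> \<kappa>"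
    and W: "P > 0 \<Longrightarrow> (\<Prod>l\<in>I. u l * q ^ (\<mu> l + \<kappa>) / (q * w l)) = W * q ^ (P - 1)"
    and i: "i < T0 \<or> (\<Sum>l\<in>I. \<mu> l + \<kappa>) < i + P"
  shows "(\<Sum>d\<le>P + T0. coeff E (P + T0 - d) * coeff (numer_poly q I u w \<mu> \<kappa> d) i) = 0"
proof -
  have degE: "degree E \<le> P + T0" unfolding E_def by (rule degree_mult_qprod_poly_le)
  have inD: "d \<in> {..\<kappa>}" if "d \<le> P + T0" for d using that \<kappa> by simp
  show ?thesis
  proof (cases "i < T0")
    case True
    obtain p where p: "degree p \<le> i" "\<And>d. d \<in> {..\<kappa>} \<Longrightarrow>
        coeff (numer_poly q I u w \<mu> \<kappa> d) i = poly p (q ^ d)"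
      using graded_family_numer_poly[OF q nru, of \<kappa> I u w \<mu>] unfolding graded_family_def by blast
    have "(\<Sum>d\<le>P + T0. coeff E (P + T0 - d) * (1 ^ d * poly p (q ^ d))) = 0"
    proof (rule annihilate_exponential_sum[OF degE])
      fix c assume "c \<le> degree p"
      then have "c < T0" using p True by simp
      then have "poly (qprod_poly q 1 T0) (1 / q ^ c) = 0"
        using q by (intro poly_qprod_poly_eq_0) auto
      then show "\<exists>y. 1 * q ^ c * y = 1 \<and> poly E y = 0"
        using q by (intro exI[of _ "1 / q ^ c"]) (simp add: E_def)
    qed
    then show ?thesis using p(2)[OF inD] by simp
  next
    case False
    define D where "D = (\<Sum>l\<in>I. \<mu> l + \<kappa>)"
    have deg: "degree (numer_poly q I u w \<mu> \<kappa> d) = D" if "d \<le> P + T0" for d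
      unfolding D_def by (rule degree_numer_poly) (use q u w that \<kappa> in auto)
    show ?thesis
    proof (cases "i > D")
      case True
      then have "coeff (numer_poly q I u w \<mu> \<kappa> d) i = 0" if "d \<le> P + T0" for d
        using deg[OF that] by (intro coeff_eq_0) simp
      then show ?thesis by simp
    next
      case le: False
      define e where "e = D - i"
      have e: "e < P" "i = D - e" "e \<le> D" using le False i unfolding e_def D_def by linarith+
      define om where "om = (\<Prod>l\<in>I. u l * q ^ (\<mu> l + \<kappa>) / (q * w l))"
      have om: "om = W * q ^ (P - 1)" using W e by (simp add: om_def)
      have om0: "om \<noteq> 0" unfolding om_def using I q u w by auto
      have "\<exists>h. \<forall>d\<le>\<kappa>. reflect_poly (numer_poly q I u w \<mu> \<kappa> d)
          = smult (h * om ^ d) (numer_poly (1 / q) I (\<lambda>l. 1 / u l) (\<lambda>l. 1 / w l) \<mu> \<kappa> d)"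
        unfolding om_def by (rule reflect_numer_poly) (use q u w in auto)
      then obtain h where h: "\<And>d. d \<le> \<kappa> \<Longrightarrow> reflect_poly (numer_poly q I u w \<mu> \<kappa> d)
          = smult (h * om ^ d) (numer_poly (1 / q) I (\<lambda>l. 1 / u l) (\<lambda>l. 1 / w l) \<mu> \<kappa> d)"
        by blast
      have q1: "1 / q \<noteq> 0" using q by simp
      obtain p where p: "degree p \<le> e" "\<And>d. d \<in> {..\<kappa>} \<Longrightarrow>
          coeff (numer_poly (1 / q) I (\<lambda>l. 1 / u l) (\<lambda>l. 1 / w l) \<mu> \<kappa> d) e = poly p ((1 / q) ^ d)"
        using graded_family_numer_poly[OF q1 inverse_not_root_of_unity[OF nru],
          of \<kappa> I "\<lambda>l. 1 / u l" "\<lambda>l. 1 / w l" \<mu>] unfolding graded_family_def by blast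
      have "coeff (numer_poly q I u w \<mu> \<kappa> d) i = h * (om ^ d * poly p ((1 / q) ^ d))" if d: "d \<le> P + T0" for d
      proof -
        have "coeff (numer_poly q I u w \<mu> \<kappa> d) i = coeff (reflect_poly (numer_poly q I u w \<mu> \<kappa> d)) e"
          using e deg[OF d] by (simp add: coeff_reflect_poly)
        also have "\<dots> = h * om ^ d * poly p ((1 / q) ^ d)"
          using h[of d] p(2)[OF inD[OF d]] d \<kappa> by simp
        finally show ?thesis by simp
      qed
      then have "(\<Sum>d\<le>P + T0. coeff E (P + T0 - d) * coeff (numer_poly q I u w \<mu> \<kappa> d) i)
          = h * (\<Sum>d\<le>P + T0. coeff E (P + T0 - d) * (om ^ d * poly p ((1 / q) ^ d)))"
        by (simp add: sum_distrib_left mult_ac)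
      also have "(\<Sum>d\<le>P + T0. coeff E (P + T0 - d) * (om ^ d * poly p ((1 / q) ^ d))) = 0"
      proof (rule annihilate_exponential_sum[OF degE])
        fix c assume "c \<le> degree p"
        then have c: "c < P" "P - 1 = c + (P - 1 - c)" using p e by simp_all
        have "q ^ c / om * W * q ^ (P - 1 - c) = W * q ^ (c + (P - 1 - c)) / om"
          by (simp add: power_add)
        also have "\<dots> = 1" using om om0 c by simp
        finally have "poly (qprod_poly q W P) (q ^ c / om) = 0"
          using c by (intro poly_qprod_poly_eq_0[of "P - 1 - c"]) auto
        then show "\<exists>y. om * (1 / q) ^ c * y = 1 \<and> poly E y = 0"
          using q om0 by (intro exI[of _ "q ^ c / om"]) (simp add: E_def power_one_over)
      qed
      finally show ?thesis by simp
    qed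
  qed
qed

text \<open>
  The powers of \<open>x\<close> that survive in the combined numerator lie between \<open>(t)\<^sub>+\<close> and the degree minus
  \<open>P\<close>; by the assumption \<open>deg\<close>, the factor \<open>x\<^bsup>-t\<^esup>\<close> moves them into the range of exponents in which the
  sums over the nodes vanish.
\<close>

lemma combination_of_residue_sums_eq_0:
  fixes q W :: complex and P \<kappa> :: nat and t :: int and x :: "'b \<Rightarrow> complex"
  defines "E \<equiv> qprod_poly q W P * qprod_poly q 1 (nat t)" and "T \<equiv> P + nat t"
  assumes q: "q \<noteq> 0" and nru: "\<And>k. q ^ Suc k \<noteq> 1"
    and u: "\<And>l. l \<in> I \<Longrightarrow> u l \<noteq> 0" and w: "\<And>l. l \<in> I \<Longrightarrow> w l \<noteq> 0" and I: "finite I"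
    and \<kappa>: "T \<le> \<kappa>"
    and W: "P > 0 \<Longrightarrow> (\<Prod>l\<in>I. u l * q ^ (\<mu> l + \<kappa>) / (q * w l)) = W * q ^ (P - 1)"
    and S: "finite S" "inj_on x S" "\<And>a. a \<in> S \<Longrightarrow> x a \<noteq> 0"
    and deg: "int (\<Sum>l\<in>I. \<mu> l + \<kappa>) + 2 \<le> int (card S) + t + int P"
  shows "(\<Sum>d\<le>T. coeff E (T - d) *
     (\<Sum>a\<in>S. x a powi (1 - t) * poly (numer_poly q I u w \<mu> \<kappa> d) (x a) / (\<Prod>b\<in>S-{a}. 1 - x a / x b))) = 0"
proof -
  define R where "R a = (\<Prod>b\<in>S-{a}. 1 - x a / x b)" for a
  define D where "D = (\<Sum>l\<in>I. \<mu> l + \<kappa>)"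
  define c where "c i = (\<Sum>d\<le>T. coeff E (T - d) * coeff (numer_poly q I u w \<mu> \<kappa> d) i)" for i
  have expand: "poly (numer_poly q I u w \<mu> \<kappa> d) y
      = (\<Sum>i\<le>D. coeff (numer_poly q I u w \<mu> \<kappa> d) i * y ^ i)" if "d \<le> T" for d y
  proof -
    have "degree (numer_poly q I u w \<mu> \<kappa> d) = D"
      unfolding D_def by (rule degree_numer_poly) (use q u w that \<kappa> in auto)
    then show ?thesis by (simp add: poly_altdef)
  qed
  have "(\<Sum>d\<le>T. coeff E (T - d) *
       (\<Sum>a\<in>S. x a powi (1 - t) * poly (numer_poly q I u w \<mu> \<kappa> d) (x a) / R a))
     = (\<Sum>d\<le>T. \<Sum>a\<in>S. \<Sum>i\<le>D. coeff E (T - d) * coeff (numer_poly q I u w \<mu> \<kappa> d) i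
          * (x a powi (1 - t) * x a ^ i / R a))"
    using expand by (simp add: sum_distrib_left sum_divide_distrib mult_ac)
  also have "\<dots> = (\<Sum>d\<le>T. \<Sum>i\<le>D. \<Sum>a\<in>S. coeff E (T - d) * coeff (numer_poly q I u w \<mu> \<kappa> d) i
          * (x a powi (1 - t) * x a ^ i / R a))"
    by (intro sum.cong refl sum.swap)
  also have "\<dots> = (\<Sum>i\<le>D. \<Sum>d\<le>T. \<Sum>a\<in>S. coeff E (T - d) * coeff (numer_poly q I u w \<mu> \<kappa> d) i
          * (x a powi (1 - t) * x a ^ i / R a))"
    by (rule sum.swap)
  also have "\<dots> = (\<Sum>i\<le>D. c i * (\<Sum>a\<in>S. x a powi (1 - t) * x a ^ i / R a))"
    unfolding c_def by (simp only: sum_distrib_left[symmetric] sum_distrib_right[symmetric])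
  also have "\<dots> = 0"
  proof (rule sum.neutral, rule ballI)
    fix i
    show "c i * (\<Sum>a\<in>S. x a powi (1 - t) * x a ^ i / R a) = 0"
    proof (cases "i < nat t \<or> D < i + P")
      case True
      then have "c i = 0"
        unfolding c_def E_def T_def D_def
        using coeff_combination_eq_0[of q I u w P "nat t" \<kappa> \<mu> W i] q nru u w I \<kappa> W by (simp add: T_def)
      then show ?thesis by simp
    next
      case False
      have "x a powi (1 - t) * x a ^ i = x a powi ((int i - t) + 1)" if "a \<in> S" for a
        using S(3)[OF that] by (simp add: power_int_add power_int_diff)
      then have "(\<Sum>a\<in>S. x a powi (1 - t) * x a ^ i / R a)
          = (\<Sum>a\<in>S. x a powi ((int i - t) + 1) / R a)" by simp
      also have "\<dots> = 0"
        unfolding R_def using False deg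
        by (intro sum_residues_eq_0 S) (auto simp: D_def[symmetric])
      finally show ?thesis by simp
    qed
  qed
  finally show ?thesis unfolding R_def .
qed

section \<open>Shifted factorials with integer index\<close>

text \<open>
  Since negative exponents give factors here and not inverse factors, ranges of exponents can be split
  and shifted even where a factor vanishes. A symbol \<^const>\<open>qpoch\<close> with negative index is the inverse of
  such a product.
\<close>

definition qint :: "complex \<Rightarrow> complex \<Rightarrow> int \<Rightarrow> int \<Rightarrow> complex" where
  "qint q a lo hi = (\<Prod>k\<in>{lo..<hi}. 1 - a * q powi k)"

lemma qint_split: "lo \<le> mid \<Longrightarrow> mid \<le> hi \<Longrightarrow> qint q a lo hi = qint q a lo mid * qint q a mid hi"
  unfolding qint_def by (subst prod.union_disjoint[symmetric]) (auto intro!: prod.cong)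

lemma qint_shift:
  assumes "q \<noteq> 0"
  shows "qint q (a * q powi s) lo hi = qint q a (lo + s) (hi + s)"
  unfolding qint_def
  by (rule prod.reindex_bij_witness[of _ "\<lambda>k. k - s" "\<lambda>k. k + s"])
     (use assms in \<open>auto simp: power_int_add\<close>)

lemma qint_from_0: "qint q a 0 (int n) = (\<Prod>k<n. 1 - a * q ^ k)"
  unfolding qint_def
  by (rule prod.reindex_bij_witness[of _ int nat]) (auto simp: power_int_def simp del: mult_cancel_left)

lemma qint_down: "qint q a (hi - int n) hi = (\<Prod>k<n. 1 - a * q powi (hi - 1 - int k))"
  unfolding qint_def
  by (rule prod.reindex_bij_witness[of _ "\<lambda>k. hi - 1 - int k" "\<lambda>k. nat (hi - 1 - k)"])
     (auto simp del: mult_cancel_left)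

lemma qint_ne_0:
  assumes "\<And>k. a * q powi k \<noteq> 1"
  shows "qint q a lo hi \<noteq> 0"
proof -
  have "1 - a * q powi k \<noteq> 0" for k
    using assms[of k] by (metis right_minus_eq)
  then show ?thesis by (simp only: qint_def prod_zero_iff finite_atLeastLessThan_int) simp
qed

lemma qpoch_nonneg_qint: "n \<ge> 0 \<Longrightarrow> qpoch q a n = qint q a 0 n"
  using qint_from_0[of q a "nat n"] by (simp add: qpoch_def)

lemma qpoch_nonpos_qint:
  assumes "n \<le> 0"
  shows "qpoch q a n = 1 / qint q a n 0"
proof (cases "n = 0")
  case True
  then show ?thesis by (simp add: qpoch_def qint_def)
next
  case False
  have "(\<Prod>k=1..nat (- n). 1 - a * q powi (- int k)) = qint q a n 0"
    unfolding qint_def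
    by (rule prod.reindex_bij_witness[of _ "\<lambda>k. nat (- k)" "\<lambda>k. - int k"]) (use assms False in auto)
  then show ?thesis using assms False by (simp add: qpoch_def prod_dividef)
qed

lemma qpoch_defined_qint: "qpoch_defined q a n \<longleftrightarrow> (n < 0 \<longrightarrow> qint q a n 0 \<noteq> 0)"
proof -
  have "(\<Prod>k=1..nat (- n). 1 - a * q powi (- int k)) = qint q a n 0"
    unfolding qint_def
    by (rule prod.reindex_bij_witness[of _ "\<lambda>k. nat (- k)" "\<lambda>k. - int k"]) auto
  moreover have "qpoch_defined q a n \<longleftrightarrow> (\<Prod>k=1..nat (- n). 1 - a * q powi (- int k)) \<noteq> 0"
    by (simp add: qpoch_defined_def)
  moreover have "n \<ge> 0 \<Longrightarrow> qint q a n 0 = 1" by (simp add: qint_def)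
  ultimately show ?thesis by (cases "n < 0") auto
qed

lemma qpoch_defined_mono:
  assumes "qpoch_defined q a n" "n \<le> n'"
  shows "qpoch_defined q a n'"
  using assms unfolding qpoch_defined_def by auto

lemma qpoch_ne_0: "(\<And>k. a * q powi k \<noteq> 1) \<Longrightarrow> qpoch q a n \<noteq> 0"
  using qint_ne_0[of a q] by (cases "n \<ge> 0") (simp_all add: qpoch_nonneg_qint qpoch_nonpos_qint)

lemma qpoch_mult_qint:
  assumes "qpoch_defined q a n" "n \<le> n'"
  shows "qpoch q a n * qint q a n n' = qpoch q a n'"
proof (cases "n \<ge> 0")
  case True
  then show ?thesis using assms qint_split[of 0 n n' q a] by (simp add: qpoch_nonneg_qint)
next
  case False
  then have nz: "qint q a n 0 \<noteq> 0" using assms by (simp add: qpoch_defined_qint)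
  show ?thesis
  proof (cases "n' \<ge> 0")
    case True
    then show ?thesis using False nz qint_split[of n 0 n' q a]
      by (simp add: qpoch_nonneg_qint qpoch_nonpos_qint)
  next
    case n': False
    then have "qint q a n 0 = qint q a n n' * qint q a n' 0" using assms by (intro qint_split) auto
    then show ?thesis using False n' nz by (simp add: qpoch_nonpos_qint)
  qed
qed

lemma qpoch_add:
  assumes "q \<noteq> 0" "qpoch_defined q a n"
  shows "qpoch q a n * qpoch q (a * q powi n) (int s) = qpoch q a (n + int s)"
  using qpoch_mult_qint[OF assms(2), of "n + int s"] qint_shift[OF assms(1), of a n 0 "int s"]
  by (simp add: qpoch_nonneg_qint add.commute)

text \<open>
  Both sides are the product over \<open>[n, 0)\<close> if \<open>n\<close> is negative. If a factor in this range vanishes, the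
  left-hand side is also \<open>0\<close>: the value of \<^const>\<open>qpoch\<close> is then \<open>1 / 0 = 0\<close>, and so is its inverse.
\<close>

lemma inverse_qpoch_qint:
  assumes "qint q a 0 N \<noteq> 0" "0 \<le> N" "n \<le> N"
  shows "1 / qpoch q a n = qint q a n N / qint q a 0 N"
proof (cases "n \<ge> 0")
  case True
  then have "qint q a 0 N = qint q a 0 n * qint q a n N" using assms by (intro qint_split) auto
  then show ?thesis using True assms by (simp add: qpoch_nonneg_qint)
next
  case False
  then have "qint q a n N = qint q a n 0 * qint q a 0 N" using assms by (intro qint_split) auto
  then show ?thesis using False assms by (simp add: qpoch_nonpos_qint)
qed

lemma qpoch_invert:
  assumes "q \<noteq> 0" "a \<noteq> 0"
  shows "qpoch q (q / a) (int s) = (- q / a) ^ s * q ^ (s * (s - 1) div 2) * qint q a (- int s) 0"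
proof (induction s)
  case 0
  show ?case by (simp add: qpoch_def qint_def)
next
  case (Suc s)
  have "qint q a (- int (Suc s)) 0 = (1 - a * q powi (- int (Suc s))) * qint q a (- int s) 0"
  proof -
    have "{- int (Suc s)..<- int s} = {- int (Suc s)}" by auto
    then have "qint q a (- int (Suc s)) (- int s) = 1 - a * q powi (- int (Suc s))"
      by (simp only: qint_def) simp
    then show ?thesis
      using qint_split[of "- int (Suc s)" "- int s" 0 q a] by simp
  qed
  moreover have "1 - q / a * q ^ s = (- q / a) * q ^ s * (1 - a * q powi (- int (Suc s)))"
    using assms by (simp add: power_int_minus field_simps del: of_nat_Suc)
  ultimately show ?case
    unfolding qpoch_Suc_nat Suc triangle_Suc power_add by (simp del: of_nat_Suc)
qed

text \<open>
  The two shifted factorials have adjacent ranges of exponents, \<open>[-s, 0)\<close> and \<open>[0, N - s)\<close>, once the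
  factors of the first one are inverted. Together they depend on \<open>a\<close> and \<open>s\<close> only through \<open>a q\<^bsup>-s\<^esup>\<close>, up
  to an explicit monomial. This is what turns the terms of a series into values of one function.
\<close>

lemma qpoch_invert_mult:
  assumes "q \<noteq> 0" "a \<noteq> 0" and d: "qpoch_defined q a (N - int s)"
  shows "qpoch q (q / a) (int s) * qpoch q a (N - int s)
       = (- q / a) ^ s * q ^ (s * (s - 1) div 2) * qpoch q (a * q powi (- int s)) N"
proof -
  have "qint q a (- int s) 0 * qpoch q a (N - int s) = qpoch q (a * q powi (- int s)) N"
  proof (cases "N \<ge> int s")
    case True
    then show ?thesis
      using qint_split[of "- int s" 0 "N - int s" q a] qint_shift[OF assms(1), of a "- int s" 0 N]
      by (simp add: qpoch_nonneg_qint)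
  next
    case F: False
    then have nz: "qint q a (N - int s) 0 \<noteq> 0" using d by (simp add: qpoch_defined_qint)
    show ?thesis
    proof (cases "N \<ge> 0")
      case True
      then show ?thesis using F nz
        using qint_split[of "- int s" "N - int s" 0 q a] qint_shift[OF assms(1), of a "- int s" 0 N]
        by (simp add: qpoch_nonneg_qint qpoch_nonpos_qint)
    next
      case False
      then show ?thesis using F nz
        using qint_split[of "N - int s" "- int s" 0 q a] qint_shift[OF assms(1), of a "- int s" N 0]
        by (simp add: qpoch_nonpos_qint)
    qed
  qed
  then show ?thesis unfolding qpoch_invert[OF assms(1,2)] by (simp add: mult.assoc)
qed

lemma qpoch_reverse:
  assumes "q \<noteq> 0" "a \<noteq> 0" and d: "qpoch_defined q a (N - int s)"
  shows "qpoch q (q powi (1 - N) / a) (int s) * qpoch q a (N - int s)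
       = (- (q powi (1 - N) / a)) ^ s * q ^ (s * (s - 1) div 2) * qpoch q a N"
proof -
  have "q powi (1 - N) / a = q / (a * q powi N)"
    using assms by (simp add: power_int_diff field_simps)
  moreover have "qint q (a * q powi N) (- int s) 0 * qpoch q a (N - int s) = qpoch q a N"
    using qpoch_mult_qint[OF d, of N] qint_shift[OF assms(1), of a N "- int s" 0] by (simp add: mult.commute)
  ultimately show ?thesis
    using qpoch_invert[of q "a * q powi N" s] assms by (simp add: mult.assoc)
qed

section \<open>The coefficients as residue sums\<close>

text \<open>
  The data of the theorem in multiplicative form, with \<open>A\<^sub>i = q\<^bsup>a\<^sub>i\<^esup>\<close> and \<open>B\<^sub>i = q\<^bsup>b\<^sub>i\<^esup>\<close>. The assumption
  \<open>separated\<close> says that the nodes \<open>A\<^sub>i q\<^sup>k\<close> are pairwise distinct for different \<open>i\<close>.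
\<close>

locale nonterminating_data =
  fixes q :: complex and I :: "'i set" and A B :: "'i \<Rightarrow> complex"
    and m n :: "'i \<Rightarrow> int" and t :: int
  assumes q: "q \<noteq> 0" and nru: "\<And>k. q ^ Suc k \<noteq> 1" and I: "finite I" "I \<noteq> {}"
    and A: "\<And>i. i \<in> I \<Longrightarrow> A i \<noteq> 0" and B: "\<And>i. i \<in> I \<Longrightarrow> B i \<noteq> 0"
    and separated: "\<And>i l k. i \<in> I \<Longrightarrow> l \<in> I \<Longrightarrow> l \<noteq> i \<Longrightarrow> A i / A l * q powi k \<noteq> 1"
    and num_defined: "\<And>i l. i \<in> I \<Longrightarrow> l \<in> I \<Longrightarrow> qpoch_defined q (q * A i / B l) (m l - n i)"
begin

definition W where "W = q powi (t + int (card I) - 1) * (\<Prod>l\<in>I. A l / B l)"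

text \<open>
  The number \<open>p + 1\<close>, as a natural number.
\<close>

definition P where "P = nat ((\<Sum>l\<in>I. m l) - (\<Sum>l\<in>I. n l) - int (card I) - t + 2)"

definition E where "E = qprod_poly q W P * qprod_poly q 1 (nat t)"

text \<open>
  The contribution of the \<open>s\<close>-th term of the first series of the \<open>i\<close>-th summand to the coefficient of
  \<open>z\<^sup>j\<close>, with the shifted factorials of the prefactor and of the second series merged.
\<close>

definition coeff_term where
  "coeff_term i j s = A i powi (1 - t) * W ^ s *
     (\<Prod>l\<in>I. qpoch q (B l / A i) (int s) * qpoch q (q * A i / B l) (m l + j - int s)) /
     (qpoch q q (int s) * qpoch q q (j + n i - int s) *
       (\<Prod>l\<in>I-{i}. qpoch q (q * A l / A i) (int s) * qpoch q (A i / A l) (n l + j + 1 - int s)))"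

definition coef where
  "coef j = (\<Sum>i\<in>I. if j + n i < 0 then 0 else \<Sum>s\<le>nat (j + n i). coeff_term i j s)"

lemma powi_ne_1: "k \<noteq> 0 \<Longrightarrow> q powi k \<noteq> 1"
proof -
  assume k: "k \<noteq> 0"
  have "q ^ nat \<bar>k\<bar> \<noteq> 1" using nru[of "nat \<bar>k\<bar> - 1"] k by (simp del: power_Suc)
  then show ?thesis by (auto simp: power_int_def abs_if power_inverse split: if_splits)
qed

text \<open>
  Every pair of shifted factorials in \<^const>\<open>coeff_term\<close> combines into a single one that depends on
  \<open>x = A\<^sub>i q\<^bsup>-s\<^esup>\<close>. The pair \<open>(q; q)\<^sub>s (q; q)\<^bsub>j + n\<^sub>i - s\<^esub>\<close> is different: there the factor with exponent \<open>0\<close>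
  vanishes at \<open>x\<close> and is left out, which is the passage to the residue at a simple pole. The
  monomials that are split off multiply with \<open>W\<^sup>s\<close> to \<open>q\<^bsup>(t - 1) s\<^esup>\<close>, and this determines the exponent
  \<open>1 - t\<close> of \<open>x\<close>.
\<close>

lemma coeff_term_eq:
  assumes i: "i \<in> I" and s: "int s \<le> j + n i"
  defines "x \<equiv> A i * q powi (- int s)"
  shows "coeff_term i j s = x powi (1 - t) * (\<Prod>l\<in>I. qpoch q (x * (q / B l)) (m l + j)) /
     (qint q 1 (- int s) 0 * qpoch q q (j + n i - int s) *
        (\<Prod>l\<in>I-{i}. qpoch q (x / A l) (n l + j + 1)))"
proof -
  define e where "e = s * (s - 1) div 2"
  have num: "qpoch q (B l / A i) (int s) * qpoch q (q * A i / B l) (m l + j - int s)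
      = (- B l / A i) ^ s * q ^ e * qpoch q (x * (q / B l)) (m l + j)" if l: "l \<in> I" for l
  proof -
    have "qpoch_defined q (q * A i / B l) (m l + j - int s)"
      by (rule qpoch_defined_mono[OF num_defined[OF i l]]) (use s in simp)
    then show ?thesis
      using qpoch_invert_mult[of q "q * A i / B l" "m l + j" s] q A[OF i] B[OF l]
      by (simp add: e_def x_def mult_ac)
  qed
  have den: "qpoch q (q * A l / A i) (int s) * qpoch q (A i / A l) (n l + j + 1 - int s)
      = (- q * A l / A i) ^ s * q ^ e * qpoch q (x / A l) (n l + j + 1)" if l: "l \<in> I - {i}" for l
  proof -
    have "qpoch_defined q (A i / A l) (n l + j + 1 - int s)"
      unfolding qpoch_defined_qint using qint_ne_0[of "A i / A l" q] separated[of i l] i l by auto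
    then show ?thesis
      using qpoch_invert_mult[of q "A i / A l" "n l + j + 1" s] q A[OF i] A[of l] l
      by (simp add: e_def x_def mult_ac)
  qed
  have den': "qpoch q q (int s) = (- q * A i / A i) ^ s * q ^ e * qint q 1 (- int s) 0"
    using qpoch_invert[of q 1 s] q A[OF i] by (simp add: e_def)
  define U where "U = (\<Prod>l\<in>I. - A l / A i)"
  have U: "U \<noteq> 0" unfolding U_def using I A i by simp
  have c1: "(\<Prod>l\<in>I. - B l / A i) = U / (\<Prod>l\<in>I. A l / B l)"
    unfolding U_def prod_dividef[symmetric] using A B by (intro prod.cong) auto
  have c2: "(- q * A i / A i) * (\<Prod>l\<in>I-{i}. - q * A l / A i) = q ^ card I * U"
  proof -
    have "(- q * A i / A i) * (\<Prod>l\<in>I-{i}. - q * A l / A i) = (\<Prod>l\<in>I. q * (- A l / A i))"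
      using I i by (simp add: prod.remove)
    also have "\<dots> = q ^ card I * U" unfolding U_def by (simp only: prod.distrib prod_constant)
    finally show ?thesis .
  qed
  define Pn where "Pn = (\<Prod>l\<in>I. qpoch q (x * (q / B l)) (m l + j))"
  define Pd where "Pd = (\<Prod>l\<in>I-{i}. qpoch q (x / A l) (n l + j + 1))"
  have n1: "(\<Prod>l\<in>I. qpoch q (B l / A i) (int s) * qpoch q (q * A i / B l) (m l + j - int s))
      = (U / (\<Prod>l\<in>I. A l / B l)) ^ s * (q ^ e) ^ card I * Pn"
    unfolding Pn_def c1[symmetric] by (simp only: num prod.distrib prod_constant prod_power_distrib cong: prod.cong)
  have d1: "qpoch q q (int s) *
       (\<Prod>l\<in>I-{i}. qpoch q (q * A l / A i) (int s) * qpoch q (A i / A l) (n l + j + 1 - int s))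
      = (q ^ card I * U) ^ s * (q ^ e) ^ card I * (qint q 1 (- int s) 0 * Pd)"
  proof -
    have "(q ^ e) ^ card I = q ^ e * (q ^ e) ^ card (I - {i})"
      unfolding card.remove[OF I(1) i] by (simp only: power_Suc)
    moreover have "(\<Prod>l\<in>I-{i}. qpoch q (q * A l / A i) (int s) * qpoch q (A i / A l) (n l + j + 1 - int s))
        = (\<Prod>l\<in>I-{i}. - q * A l / A i) ^ s * (q ^ e) ^ card (I - {i}) * Pd"
      unfolding Pd_def by (simp only: den prod.distrib prod_constant prod_power_distrib cong: prod.cong)
    ultimately show ?thesis
      unfolding den' c2[symmetric] by (simp only: power_mult_distrib mult_ac)
  qed
  have AB: "(\<Prod>l\<in>I. A l / B l) \<noteq> 0" using I A B by simp
  have "W * (U / (\<Prod>l\<in>I. A l / B l)) / (q ^ card I * U) = q powi (t - 1)"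
  proof -
    have "q powi (t + int (card I) - 1) = q powi (t - 1) * q ^ card I"
      using q by (simp add: power_int_add power_int_diff)
    then show ?thesis unfolding W_def using U AB q by simp
  qed
  then have "W ^ s * (U / (\<Prod>l\<in>I. A l / B l)) ^ s / (q ^ card I * U) ^ s = (q powi (t - 1)) ^ s"
    by (simp only: power_divide[symmetric] power_mult_distrib[symmetric])
  moreover have "x powi (1 - t) = A i powi (1 - t) * (q powi (t - 1)) ^ s"
  proof -
    have "(q powi (- int s)) powi (1 - t) = (q powi (t - 1)) powi (int s)"
      unfolding power_int_mult[symmetric] by (simp add: algebra_simps)
    then show ?thesis by (simp add: x_def power_int_mult_distrib)
  qed
  moreover have "coeff_term i j s = A i powi (1 - t) *
      (W ^ s * (U / (\<Prod>l\<in>I. A l / B l)) ^ s / (q ^ card I * U) ^ s)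
      * Pn / (qint q 1 (- int s) 0 * qpoch q q (j + n i - int s) * Pd)"
  proof -
    have "coeff_term i j s = A i powi (1 - t) * W ^ s * ((U / (\<Prod>l\<in>I. A l / B l)) ^ s * (q ^ e) ^ card I * Pn)
        / ((qpoch q q (int s) *
       (\<Prod>l\<in>I-{i}. qpoch q (q * A l / A i) (int s) * qpoch q (A i / A l) (n l + j + 1 - int s)))
           * qpoch q q (j + n i - int s))"
      unfolding coeff_term_def n1 by (simp only: mult_ac)
    then show ?thesis unfolding d1 using q by (simp add: mult_ac)
  qed
  ultimately show ?thesis by (simp add: Pn_def Pd_def)
qed

text \<open>
  The zeros of the common denominator \<open>\<Prod>\<^sub>l (x / A\<^sub>l; q)\<^bsub>n\<^sub>l + K + 1\<^esub>\<close> are indexed by pairs, and \<open>K\<close> is an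
  upper bound for the indices \<open>j\<close> under consideration.
\<close>

definition node where "node = (\<lambda>(l, k). A l * q powi (- int k))"

definition nodes where "nodes K = (SIGMA l:I. {..<nat (n l + K + 1)})"

definition numer where
  "numer K j y = (\<Prod>l\<in>I. qint q (y * (q / B l)) 0 (m l + j) * qint q (y / A l) (n l + j + 1) (n l + K + 1))"

lemma finite_nodes: "finite (nodes K)"
  using I by (simp add: nodes_def)

lemma node_ne_0: "a \<in> nodes K \<Longrightarrow> node a \<noteq> 0"
  using A q by (auto simp: nodes_def node_def)

lemma powi_eq_iff: "q powi k = q powi k' \<longleftrightarrow> k = k'"
  using powi_ne_1[of "k - k'"] q by (auto simp: power_int_diff)

lemma inj_on_node: "inj_on node (nodes K)"
proof (rule inj_onI)
  fix a b assume ab: "a \<in> nodes K" "b \<in> nodes K" and eq: "node a = node b"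
  obtain i s l k where [simp]: "a = (i, s)" "b = (l, k)" by fastforce
  have il: "i \<in> I" "l \<in> I" using ab by (auto simp: nodes_def)
  have eq': "A i * q powi (- int s) = A l * q powi (- int k)" using eq by (simp add: node_def)
  have "A i / A l * q powi (int k - int s) = A i * q powi (- int s) * q powi (int k) / A l"
    using q by (simp add: power_int_diff power_int_minus field_simps)
  also have "\<dots> = 1"
    unfolding eq' using q A[OF il(2)] by (simp add: power_int_minus field_simps)
  finally have "l = i" using separated[OF il] by blast
  then have "q powi (- int s) = q powi (- int k)" using eq' A[OF il(2)] by simp
  then show "a = b" using \<open>l = i\<close> by (simp add: powi_eq_iff)
qed

lemma qint_1_ne_0: "0 \<notin> {lo..<hi} \<Longrightarrow> qint q 1 lo hi \<noteq> 0"
proof -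
  assume "0 \<notin> {lo..<hi}"
  then have "1 - 1 * q powi k \<noteq> 0" if "k \<in> {lo..<hi}" for k
    using powi_ne_1[of k] that by fastforce
  then show ?thesis unfolding qint_def by (simp only: prod_zero_iff finite_atLeastLessThan_int) simp
qed

lemma qpoch_q_q: "k \<ge> 0 \<Longrightarrow> qpoch q q k = qint q 1 1 (k + 1)"
  using qint_shift[OF q, of 1 1 0 k] by (simp add: qpoch_nonneg_qint add.commute)

lemma prod_nodes:
  assumes a: "(i, s) \<in> nodes K" and K: "\<And>l. l \<in> I \<Longrightarrow> 0 \<le> n l + K"
  defines "x \<equiv> node (i, s)"
  shows "(\<Prod>b\<in>nodes K - {(i, s)}. 1 - x / node b)
    = (\<Prod>l\<in>I-{i}. qint q (x / A l) 0 (n l + K + 1)) * (qint q 1 (- int s) 0 * qint q 1 1 (n i + K + 1 - int s))"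
proof -
  have i: "i \<in> I" and s: "s < nat (n i + K + 1)" using a by (auto simp: nodes_def)
  define ks where "ks l = {..<nat (n l + K + 1)} - (if l = i then {s} else {})" for l
  have "nodes K - {(i, s)} = (SIGMA l:I. ks l)"
    by (auto simp: nodes_def ks_def split: if_splits)
  then have "(\<Prod>b\<in>nodes K - {(i, s)}. 1 - x / node b) = (\<Prod>l\<in>I. \<Prod>k\<in>ks l. 1 - x / node (l, k))"
    using I by (simp add: prod.Sigma ks_def)
  also have "\<dots> = (\<Prod>k\<in>ks i. 1 - x / node (i, k)) * (\<Prod>l\<in>I-{i}. \<Prod>k\<in>ks l. 1 - x / node (l, k))"
    by (rule prod.remove[OF I(1) i])
  also have "(\<Prod>l\<in>I-{i}. \<Prod>k\<in>ks l. 1 - x / node (l, k)) = (\<Prod>l\<in>I-{i}. qint q (x / A l) 0 (n l + K + 1))"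
  proof (rule prod.cong)
    fix l assume l: "l \<in> I - {i}"
    have "x / node (l, k) = x / A l * q ^ k" for k
      using q by (simp add: node_def power_int_minus field_simps)
    then show "(\<Prod>k\<in>ks l. 1 - x / node (l, k)) = qint q (x / A l) 0 (n l + K + 1)"
      using l K[of l] qint_from_0[of q "x / A l" "nat (n l + K + 1)"] by (simp add: ks_def)
  qed simp
  also have "(\<Prod>k\<in>ks i. 1 - x / node (i, k)) = qint q 1 (- int s) 0 * qint q 1 1 (n i + K + 1 - int s)"
  proof -
    have "(\<Prod>k\<in>ks i. 1 - x / node (i, k))
        = (\<Prod>k\<in>{- int s..<0} \<union> {1..<n i + K + 1 - int s}. 1 - 1 * q powi k)"
    proof (rule prod.reindex_bij_witness[of _ "\<lambda>k. nat (k + int s)" "\<lambda>k. int k - int s"])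
      fix k assume "k \<in> ks i"
      show "1 - 1 * q powi (int k - int s) = 1 - x / node (i, k)"
        using q A[OF i] by (simp add: x_def node_def power_int_minus power_int_diff field_simps)
    qed (use s in \<open>auto simp: ks_def\<close>)
    also have "\<dots> = qint q 1 (- int s) 0 * qint q 1 1 (n i + K + 1 - int s)"
      unfolding qint_def by (rule prod.union_disjoint) auto
    finally show ?thesis .
  qed
  finally show ?thesis by (simp only: mult.commute)
qed

text \<open>
  The additional nodes \<open>A\<^sub>i q\<^bsup>-s\<^esup>\<close> with \<open>s > n\<^sub>i + j\<close>, which come from the enlarged denominator, contribute
  nothing: there the enlarged numerator vanishes. At the other nodes the surplus factors cancel.
\<close>

lemma coef_eq_residue_sum:
  assumes mj: "\<And>l. l \<in> I \<Longrightarrow> 0 \<le> m l + j" and K: "\<And>l. l \<in> I \<Longrightarrow> 0 \<le> n l + K" and jK: "j \<le> K"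
  shows "coef j = (\<Sum>a\<in>nodes K. node a powi (1 - t) * numer K j (node a) /
           (\<Prod>b\<in>nodes K-{a}. 1 - node a / node b))"
proof -
  define F where "F a = node a powi (1 - t) * numer K j (node a) / (\<Prod>b\<in>nodes K-{a}. 1 - node a / node b)" for a
  have node_same: "node (i, s) / A i = q powi (- int s)" if "i \<in> I" for i s
    using A[OF that] by (simp add: node_def)
  have zero: "F (i, s) = 0" if "(i, s) \<in> nodes K" "int s > j + n i" for i s
  proof -
    have i: "i \<in> I" "int s < n i + K + 1" using that by (auto simp: nodes_def)
    have "qint q (q powi (- int s)) (n i + j + 1) (n i + K + 1) = 0"
      unfolding qint_def
      by (rule prod_zero) (use i that q in \<open>auto simp: power_int_minus intro!: bexI[of _ "int s"]\<close>)
    then have "numer K j (node (i, s)) = 0"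
      unfolding numer_def using i I node_same by (intro prod_zero bexI[of _ i]) auto
    then show ?thesis by (simp add: F_def)
  qed
  have eq: "F (i, s) = coeff_term i j s" if i: "i \<in> I" and s: "int s \<le> j + n i" for i s
  proof -
    define x where "x = node (i, s)"
    have x: "x = A i * q powi (- int s)" by (simp add: x_def node_def)
    have mem: "(i, s) \<in> nodes K" using i s jK by (auto simp: nodes_def)
    define N where "N = (\<Prod>l\<in>I. qint q (x * (q / B l)) 0 (m l + j))"
    define R where "R = (\<Prod>l\<in>I-{i}. qint q (x / A l) (n l + j + 1) (n l + K + 1))"
    define D where "D = (\<Prod>l\<in>I-{i}. qint q (x / A l) 0 (n l + K + 1))"
    have RD: "R / D = 1 / (\<Prod>l\<in>I-{i}. qpoch q (x / A l) (n l + j + 1))"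
    proof -
      have "qint q (x / A l) (n l + j + 1) (n l + K + 1) / qint q (x / A l) 0 (n l + K + 1)
          = 1 / qpoch q (x / A l) (n l + j + 1)" if l: "l \<in> I - {i}" for l
      proof (rule inverse_qpoch_qint[symmetric])
        show "qint q (x / A l) 0 (n l + K + 1) \<noteq> 0"
        proof (rule qint_ne_0)
          fix k
          have eq: "x / A l * q powi k = A i / A l * q powi (k - int s)"
            using q by (simp add: x power_int_diff power_int_minus field_simps)
          show "x / A l * q powi k \<noteq> 1" unfolding eq using i l by (intro separated) auto
        qed
      qed (use K[of l] l jK in auto)
      then show ?thesis unfolding R_def D_def prod_dividef[symmetric] by (simp add: prod_dividef)
    qed
    define c where "c = qint q 1 (n i + j + 1 - int s) (n i + K + 1 - int s)"
    have c: "c \<noteq> 0" unfolding c_def using s by (intro qint_1_ne_0) auto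
    have "numer K j x = N * ((\<Prod>l\<in>I. qint q (x / A l) (n l + j + 1) (n l + K + 1)))"
      by (simp add: numer_def N_def prod.distrib)
    also have "(\<Prod>l\<in>I. qint q (x / A l) (n l + j + 1) (n l + K + 1)) = c * R"
      unfolding R_def prod.remove[OF I(1) i]
      using node_same[OF i, of s] qint_shift[OF q, of 1 "- int s"] by (simp add: x_def c_def)
    finally have 1: "numer K j x = N * (c * R)" .
    have "qint q 1 1 (n i + K + 1 - int s) = qpoch q q (j + n i - int s) * c"
      using qint_split[of 1 "n i + j + 1 - int s" "n i + K + 1 - int s" q 1] s jK
      by (simp add: qpoch_q_q c_def algebra_simps)
    then have 2: "(\<Prod>b\<in>nodes K - {(i, s)}. 1 - x / node b)
        = D * (qint q 1 (- int s) 0 * (qpoch q q (j + n i - int s) * c))"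
      unfolding x_def using prod_nodes[OF mem K] by (simp add: D_def x_def)
    have "F (i, s) = x powi (1 - t) * N * (R / D) * (c / c)
        / (qint q 1 (- int s) 0 * qpoch q q (j + n i - int s))"
      unfolding F_def x_def[symmetric] 1 2 by simp
    also have "\<dots> = coeff_term i j s"
      unfolding RD coeff_term_eq[OF i s] x[symmetric] using c mj
      by (simp add: N_def qpoch_nonneg_qint)
    finally show ?thesis .
  qed
  have "(\<Sum>a\<in>nodes K. F a) = (\<Sum>i\<in>I. \<Sum>s<nat (n i + K + 1). F (i, s))"
    unfolding nodes_def using I by (simp add: sum.Sigma)
  also have "\<dots> = (\<Sum>i\<in>I. if j + n i < 0 then 0 else \<Sum>s\<le>nat (j + n i). coeff_term i j s)"
  proof (rule sum.cong)
    fix i assume i: "i \<in> I"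
    have "(\<Sum>s<nat (n i + K + 1). F (i, s)) = (\<Sum>s | int s \<le> j + n i. F (i, s))"
      by (rule sum.mono_neutral_right) (use i jK zero in \<open>auto simp: nodes_def not_le\<close>)
    also have "\<dots> = (\<Sum>s | int s \<le> j + n i. coeff_term i j s)"
      using eq i by (intro sum.cong) auto
    also have "{s. int s \<le> j + n i} = (if j + n i < 0 then {} else {..nat (j + n i)})"
      by auto
    finally show "(\<Sum>s<nat (n i + K + 1). F (i, s))
        = (if j + n i < 0 then 0 else \<Sum>s\<le>nat (j + n i). coeff_term i j s)" by auto
  qed simp
  finally show ?thesis unfolding coef_def F_def by simp
qed

lemma poly_numer_poly_eq_numer:
  assumes "\<And>l. l \<in> I \<Longrightarrow> 0 \<le> m l + j0" "\<And>l. l \<in> I \<Longrightarrow> 0 \<le> n l + K" "d \<le> \<kappa>" "K = j0 + int \<kappa>"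
  shows "poly (numer_poly q I (\<lambda>l. q / B l) (\<lambda>l. q powi (n l + K) / A l) (\<lambda>l. nat (m l + j0)) \<kappa> d) y
     = numer K (j0 + int d) y"
  unfolding numer_poly_def numer_def poly_prod poly_mult
proof (intro prod.cong arg_cong2[where f = "(*)"] refl)
  fix l assume l: "l \<in> I"
  show "poly (qprod_poly q (q / B l) (nat (m l + j0) + d)) y = qint q (y * (q / B l)) 0 (m l + (j0 + int d))"
    using qint_from_0[of q "y * (q / B l)" "nat (m l + j0) + d"] assms(1)[OF l]
    by (simp add: poly_qprod_poly add.assoc)
  have "q powi (n l + K) * (1 / q) ^ k = q powi (n l + K + 1 - 1 - int k)" for k
    using q by (simp add: power_int_diff power_one_over)
  then show "poly (qprod_poly (1 / q) (q powi (n l + K) / A l) (\<kappa> - d)) y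
      = qint q (y / A l) (n l + (j0 + int d) + 1) (n l + K + 1)"
    using qint_down[of q "y / A l" "n l + K + 1" "\<kappa> - d"] assms(3,4)
    by (simp add: poly_qprod_poly of_nat_diff algebra_simps)
qed

lemma card_nodes:
  assumes "\<And>l. l \<in> I \<Longrightarrow> 0 \<le> n l + K"
  shows "int (card (nodes K)) = (\<Sum>l\<in>I. n l) + int (card I) * (K + 1)"
  using I assms by (simp add: nodes_def sum.distrib flip: add.assoc) (simp add: algebra_simps sum.distrib)

text \<open>
  All indices from \<open>k - P - (t)\<^sub>+\<close> to \<open>k\<close> are treated over one denominator. The bound \<open>K\<close> is
  taken so large that it is at least \<open>k\<close> and every \<open>- n\<^sub>l\<close>, which makes the denominator a polynomial and a
  multiple of all the individual ones.
\<close>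

lemma combination_of_coefs_eq_0:
  assumes k: "\<And>l. l \<in> I \<Longrightarrow> 0 \<le> m l + (k - int (P + nat t))"
  shows "(\<Sum>e\<le>P + nat t. coeff E e * coef (k - int e)) = 0"
proof -
  define T where "T = P + nat t"
  define j0 where "j0 = k - int T"
  define \<kappa> where "\<kappa> = T + nat (\<Sum>l\<in>I. \<bar>n l\<bar>) + nat \<bar>k\<bar>"
  define K where "K = j0 + int \<kappa>"
  have mj0: "0 \<le> m l + j0" if "l \<in> I" for l using k[OF that] by (simp add: j0_def T_def)
  have K0: "0 \<le> n l + K" if "l \<in> I" for l
  proof -
    have "\<bar>n l\<bar> \<le> (\<Sum>l\<in>I. \<bar>n l\<bar>)" using I that by (intro member_le_sum) auto
    then show ?thesis unfolding K_def \<kappa>_def j0_def by linarith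
  qed
  define num where
    "num = numer_poly q I (\<lambda>l. q / B l) (\<lambda>l. q powi (n l + K) / A l) (\<lambda>l. nat (m l + j0)) \<kappa>"
  have mu: "int (\<Sum>l\<in>I. nat (m l + j0) + \<kappa>) = (\<Sum>l\<in>I. m l) + int (card I) * K"
    using mj0 by (simp add: sum.distrib K_def algebra_simps)
  have coef: "coef (j0 + int d) = (\<Sum>a\<in>nodes K. node a powi (1 - t) * poly (num d) (node a) /
           (\<Prod>b\<in>nodes K-{a}. 1 - node a / node b))" if "d \<le> T" for d
  proof -
    have d: "d \<le> \<kappa>" using that by (simp add: \<kappa>_def)
    have poly_num: "poly (num d) y = numer K (j0 + int d) y" for y
      unfolding num_def by (rule poly_numer_poly_eq_numer) (use mj0 K0 d K_def in auto)
    show ?thesis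
      unfolding poly_num
    proof (rule coef_eq_residue_sum)
      show "0 \<le> m l + (j0 + int d)" if "l \<in> I" for l using mj0[OF that] by simp
      show "j0 + int d \<le> K" using d by (simp add: K_def)
    qed (rule K0)
  qed
  have "(\<Sum>d\<le>T. coeff E (T - d) * coef (j0 + int d)) = 0"
    unfolding E_def T_def
  proof (subst sum.cong[OF refl])
    show "coeff (qprod_poly q W P * qprod_poly q 1 (nat t)) (P + nat t - d) * coef (j0 + int d)
      = coeff (qprod_poly q W P * qprod_poly q 1 (nat t)) (P + nat t - d) *
        (\<Sum>a\<in>nodes K. node a powi (1 - t) * poly (num d) (node a) / (\<Prod>b\<in>nodes K-{a}. 1 - node a / node b))"
      if "d \<in> {..P + nat t}" for d using coef[of d] that by (simp add: T_def)
    show "(\<Sum>d\<le>P + nat t. coeff (qprod_poly q W P * qprod_poly q 1 (nat t)) (P + nat t - d) *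
        (\<Sum>a\<in>nodes K. node a powi (1 - t) * poly (num d) (node a) / (\<Prod>b\<in>nodes K-{a}. 1 - node a / node b))) = 0"
      unfolding num_def
    proof (rule combination_of_residue_sums_eq_0[OF q nru])
      show "finite I" by (rule I)
      show "P + nat t \<le> \<kappa>" by (simp add: \<kappa>_def T_def)
      show "finite (nodes K)" "inj_on node (nodes K)" by (rule finite_nodes inj_on_node)+
      show "node a \<noteq> 0" if "a \<in> nodes K" for a using node_ne_0 that .
      show "q / B l \<noteq> 0" "q powi (n l + K) / A l \<noteq> 0" if "l \<in> I" for l using q A B that by auto
      show "int (\<Sum>l\<in>I. nat (m l + j0) + \<kappa>) + 2 \<le> int (card (nodes K)) + t + int P"
        using card_nodes[of K] K0 unfolding mu P_def by (simp add: algebra_simps)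
      assume "P > 0"
      then have P: "int P = (\<Sum>l\<in>I. m l) - (\<Sum>l\<in>I. n l) - int (card I) - t + 2" by (simp add: P_def)
      \<comment> \<open>For \<open>P > 0\<close> the sum of the \<open>m\<^sub>l - n\<^sub>l\<close> is \<open>(t + card I - 1) + (P - 1)\<close>, so the ratio is \<open>W q\<^bsup>P-1\<^esup>\<close>.\<close>
      have "(\<Prod>l\<in>I. q / B l * q ^ (nat (m l + j0) + \<kappa>) / (q * (q powi (n l + K) / A l)))
          = (\<Prod>l\<in>I. A l / B l * q powi (m l - n l))"
      proof (rule prod.cong)
        fix l assume l: "l \<in> I"
        have "q ^ (nat (m l + j0) + \<kappa>) = q powi (int (nat (m l + j0) + \<kappa>))"
          by (simp only: power_int_of_nat)
        also have "int (nat (m l + j0) + \<kappa>) = (m l - n l) + (n l + K)" using mj0[OF l] by (simp add: K_def)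
        finally have "q ^ (nat (m l + j0) + \<kappa>) = q powi (m l - n l) * q powi (n l + K)"
          by (simp only: power_int_add[of q "m l - n l" "n l + K", OF disjI1[OF q]])
        then show "q / B l * q ^ (nat (m l + j0) + \<kappa>) / (q * (q powi (n l + K) / A l))
            = A l / B l * q powi (m l - n l)" using q by simp
      qed simp
      also have "\<dots> = (\<Prod>l\<in>I. A l / B l) * q powi (\<Sum>l\<in>I. m l - n l)"
      proof -
        have "(\<Prod>l\<in>F. q powi f l) = q powi (\<Sum>l\<in>F. f l)" if "finite F" for F and f :: "'i \<Rightarrow> int"
          using that by induction (use q in \<open>simp_all add: power_int_add\<close>)
        then show ?thesis using I by (simp only: prod.distrib)
      qed
      also have "(\<Sum>l\<in>I. m l - n l) = (t + int (card I) - 1) + int (P - 1)"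
        using P \<open>P > 0\<close> by (simp add: sum_subtractf of_nat_diff)
      also have "(\<Prod>l\<in>I. A l / B l) * q powi ((t + int (card I) - 1) + int (P - 1)) = W * q ^ (P - 1)"
        by (simp only: power_int_add[of q "t + int (card I) - 1" "int (P - 1)", OF disjI1[OF q]]
              W_def power_int_of_nat mult_ac)
      finally show "(\<Prod>l\<in>I. q / B l * q ^ (nat (m l + j0) + \<kappa>) / (q * (q powi (n l + K) / A l)))
          = W * q ^ (P - 1)" .
    qed
  qed
  moreover have "(\<Sum>e\<le>T. coeff E e * coef (k - int e)) = (\<Sum>d\<le>T. coeff E (T - d) * coef (j0 + int d))"
    by (rule sum.reindex_bij_witness[of _ "\<lambda>d. T - d" "\<lambda>d. T - d"]) (auto simp: j0_def of_nat_diff)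
  ultimately show ?thesis by (simp add: T_def)
qed

end

section \<open>Generating functions\<close>

text \<open>
  Ratio test: the quotient of successive terms tends to \<open>z\<close>, because \<open>q\<^sup>s\<close> tends to \<open>0\<close>. If a
  denominator vanishes, all terms from there on are \<open>0\<close>, and the relation between successive terms persists.
\<close>

lemma summable_norm_qpoch_series:
  fixes q z :: complex
  assumes "norm q < 1" "norm z < 1" "finite I" "finite J"
  shows "summable (\<lambda>s. norm ((\<Prod>l\<in>I. qpoch q (c l) (int s)) /
      ((\<Prod>l\<in>J. qpoch q (d l) (int s)) * qpoch q q (int s)) * z ^ s))"
proof -
  define f where "f s = (\<Prod>l\<in>I. qpoch q (c l) (int s)) /
      ((\<Prod>l\<in>J. qpoch q (d l) (int s)) * qpoch q q (int s)) * z ^ s" for s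
  define \<rho> where "\<rho> s = (\<Prod>l\<in>I. 1 - c l * q ^ s) / ((\<Prod>l\<in>J. 1 - d l * q ^ s) * (1 - q * q ^ s)) * z" for s
  have step: "f (Suc s) = f s * \<rho> s" for s
    unfolding f_def \<rho>_def qpoch_Suc_nat prod.distrib
    by (simp only: power_Suc divide_inverse inverse_mult_distrib mult_ac)
  have q0: "(\<lambda>s. q ^ s) \<longlonglongrightarrow> 0" using assms(1) by (rule LIMSEQ_power_zero)
  have "\<rho> \<longlonglongrightarrow> (\<Prod>l\<in>I. 1 - c l * 0) / ((\<Prod>l\<in>J. 1 - d l * 0) * (1 - q * 0)) * z"
    unfolding \<rho>_def by (intro tendsto_intros q0) simp
  then have "(\<lambda>s. norm (\<rho> s)) \<longlonglongrightarrow> norm z" by (intro tendsto_norm) simp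
  moreover define b where "b = (1 + norm z) / 2"
  ultimately have "eventually (\<lambda>s. norm (\<rho> s) < b) sequentially"
    using assms(2) by (intro order_tendstoD(2)) (auto simp: b_def)
  then obtain N where N: "\<And>s. s \<ge> N \<Longrightarrow> norm (\<rho> s) < b"
    unfolding eventually_sequentially by blast
  have "summable (\<lambda>s. norm (f s))"
  proof (rule summable_ratio_test)
    show "b < 1" using assms(2) by (simp add: b_def)
    fix s assume "s \<ge> N"
    then have "norm (f s) * norm (\<rho> s) \<le> norm (f s) * b"
      by (intro mult_left_mono less_imp_le[OF N]) auto
    then show "norm (norm (f (Suc s))) \<le> b * norm (norm (f s))"
      by (simp add: step norm_mult mult.commute)
  qed
  then show ?thesis by (simp only: f_def)
qed

lemma summable_norm_Cauchy_product:
  fixes f g :: "nat \<Rightarrow> complex"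
  assumes "summable (\<lambda>k. norm (f k))" "summable (\<lambda>k. norm (g k))"
  shows "summable (\<lambda>k. norm (\<Sum>i\<le>k. f i * g (k - i)))"
proof (rule summable_comparison_test')
  show "summable (\<lambda>k. \<Sum>i\<le>k. norm (f i) * norm (g (k - i)))"
    using assms by (intro summable_Cauchy_product) auto
  show "norm (norm (\<Sum>i\<le>k. f i * g (k - i))) \<le> (\<Sum>i\<le>k. norm (f i) * norm (g (k - i)))" for k
    by (simp add: norm_mult[symmetric]) (rule norm_sum)
qed

lemma sums_delay:
  fixes f :: "nat \<Rightarrow> complex"
  assumes "f sums S" "summable (\<lambda>k. norm (f k))"
  shows "(\<lambda>k. if k < h then 0 else f (k - h)) sums S"
    and "summable (\<lambda>k. norm (if k < h then 0 else f (k - h)))"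
proof -
  show "(\<lambda>k. if k < h then 0 else f (k - h)) sums S"
    using assms(1) by (subst sums_zero_iff_shift[of h, symmetric]) auto
  show "summable (\<lambda>k. norm (if k < h then 0 else f (k - h)))"
    using assms(2) by (subst summable_iff_shift[of _ h, symmetric]) simp
qed

context nonterminating_data
begin

definition left_series where
  "left_series i w = (\<Sum>s. (\<Prod>l\<in>I. qpoch q (B l / A i) (int s)) /
     ((\<Prod>l\<in>I-{i}. qpoch q (q * A l / A i) (int s)) * qpoch q q (int s)) * w ^ s)"

definition right_series where
  "right_series i z = (\<Sum>s. (\<Prod>l\<in>I. qpoch q (q * A i / B l * q powi (m l - n i)) (int s)) /
     ((\<Prod>l\<in>I-{i}. qpoch q (A i / A l * q powi (n l - n i + 1)) (int s)) * qpoch q q (int s)) * z ^ s)"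

definition prefactor where
  "prefactor i = A i powi (1 - t) * ((\<Prod>l\<in>I. qpoch q (q * A i / B l) (m l - n i)) /
     (\<Prod>l\<in>I-{i}. qpoch q (A i / A l) (n l - n i + 1)))"

text \<open>
  The exponent of \<open>z\<close> contributed by the terms \<open>s\<close> and \<open>u\<close> of the two series is \<open>s + u - n\<^sub>i\<close>. The
  factorials of the prefactor are the initial segments of those in the second series.
\<close>

lemma coeff_term_product:
  assumes i: "i \<in> I"
  shows "coeff_term i (int (s + u) - n i) s = prefactor i *
    ((\<Prod>l\<in>I. qpoch q (B l / A i) (int s)) /
     ((\<Prod>l\<in>I-{i}. qpoch q (q * A l / A i) (int s)) * qpoch q q (int s)) * W ^ s) *
    ((\<Prod>l\<in>I. qpoch q (q * A i / B l * q powi (m l - n i)) (int u)) /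
     ((\<Prod>l\<in>I-{i}. qpoch q (A i / A l * q powi (n l - n i + 1)) (int u)) * qpoch q q (int u)))"
proof -
  have 1: "qpoch q (q * A i / B l) (m l + (int (s + u) - n i) - int s)
      = qpoch q (q * A i / B l) (m l - n i) * qpoch q (q * A i / B l * q powi (m l - n i)) (int u)"
    if "l \<in> I" for l
    by (subst qpoch_add[OF q num_defined[OF i that]]) (simp add: algebra_simps)
  have 2: "qpoch q (A i / A l) (n l + (int (s + u) - n i) + 1 - int s)
      = qpoch q (A i / A l) (n l - n i + 1) * qpoch q (A i / A l * q powi (n l - n i + 1)) (int u)"
    if "l \<in> I - {i}" for l
  proof -
    have "qpoch_defined q (A i / A l) (n l - n i + 1)"
      unfolding qpoch_defined_qint using qint_ne_0[of "A i / A l" q] separated[of i l] i that by auto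
    from qpoch_add[OF q this, of u] show ?thesis by (simp add: algebra_simps)
  qed
  have 3: "int (s + u) - n i + n i - int s = int u" by simp
  have n1: "(\<Prod>l\<in>I. qpoch q (B l / A i) (int s) * qpoch q (q * A i / B l) (m l + (int (s + u) - n i) - int s))
     = (\<Prod>l\<in>I. qpoch q (B l / A i) (int s)) * ((\<Prod>l\<in>I. qpoch q (q * A i / B l) (m l - n i)) *
         (\<Prod>l\<in>I. qpoch q (q * A i / B l * q powi (m l - n i)) (int u)))"
    by (simp only: 1 prod.distrib cong: prod.cong)
  have n2: "(\<Prod>l\<in>I-{i}. qpoch q (q * A l / A i) (int s) * qpoch q (A i / A l) (n l + (int (s + u) - n i) + 1 - int s))
     = (\<Prod>l\<in>I-{i}. qpoch q (q * A l / A i) (int s)) * ((\<Prod>l\<in>I-{i}. qpoch q (A i / A l) (n l - n i + 1)) *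
         (\<Prod>l\<in>I-{i}. qpoch q (A i / A l * q powi (n l - n i + 1)) (int u)))"
    by (simp only: 2 prod.distrib cong: prod.cong)
  show ?thesis unfolding coeff_term_def prefactor_def n1 n2 3
    by (simp only: divide_inverse inverse_mult_distrib mult_ac)
qed

text \<open>
  The summands start at the different powers \<open>z\<^bsup>-n\<^sub>i\<^esup>\<close>. They are delayed to the common start \<open>z\<^bsup>-N0\<^esup>\<close>, so
  that power series with natural exponents suffice.
\<close>

lemma coef_generating_function:
  assumes "norm q < 1" "norm z < 1" "norm (W * z) < 1" "z \<noteq> 0"
    and N0: "\<And>i. i \<in> I \<Longrightarrow> n i \<le> N0"
  defines "G \<equiv> (\<Sum>i\<in>I. z powi (- n i) * prefactor i * left_series i (W * z) * right_series i z)"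
  shows "(\<lambda>k. coef (int k - N0) * z ^ k) sums (z powi N0 * G)"
    and "summable (\<lambda>k. norm (coef (int k - N0) * z ^ k))"
proof -
  define g where "g i k = (if int k - N0 + n i < 0 then 0 else
      \<Sum>s\<le>nat (int k - N0 + n i). coeff_term i (int k - N0) s) * z ^ k" for i k
  have coef: "coef (int k - N0) * z ^ k = (\<Sum>i\<in>I. g i k)" for k
    unfolding coef_def g_def by (simp only: sum_distrib_right)
  have g: "g i sums (z powi (N0 - n i) * prefactor i * left_series i (W * z) * right_series i z)
      \<and> summable (\<lambda>k. norm (g i k))" if i: "i \<in> I" for i
  proof -
    define h where "h = nat (N0 - n i)"
    have h: "int h = N0 - n i" using N0[OF i] by (simp add: h_def)
    define f1 where "f1 s = (\<Prod>l\<in>I. qpoch q (B l / A i) (int s)) /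
       ((\<Prod>l\<in>I-{i}. qpoch q (q * A l / A i) (int s)) * qpoch q q (int s)) * (W * z) ^ s" for s
    define f2 where "f2 s = (\<Prod>l\<in>I. qpoch q (q * A i / B l * q powi (m l - n i)) (int s)) /
       ((\<Prod>l\<in>I-{i}. qpoch q (A i / A l * q powi (n l - n i + 1)) (int s)) * qpoch q q (int s)) * z ^ s" for s
    have s1: "summable (\<lambda>s. norm (f1 s))" and s2: "summable (\<lambda>s. norm (f2 s))"
      unfolding f1_def f2_def using assms(1-3) I by (intro summable_norm_qpoch_series; simp)+
    define p where "p k = (\<Sum>s\<le>k. f1 s * f2 (k - s))" for k
    define C where "C = z ^ h * prefactor i"
    have p: "p sums (left_series i (W * z) * right_series i z)" "summable (\<lambda>k. norm (p k))"
      unfolding p_def left_series_def right_series_def f1_def[symmetric] f2_def[symmetric]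
      using Cauchy_product_sums[OF s1 s2] summable_norm_Cauchy_product[OF s1 s2] by auto
    then have "(\<lambda>k. C * p k) sums (C * (left_series i (W * z) * right_series i z))"
        "summable (\<lambda>k. norm (C * p k))"
      by (auto intro: sums_mult summable_mult simp: norm_mult)
    note d = sums_delay[OF this, of h]
    have "g i k = (if k < h then 0 else C * p (k - h))" for k
    proof (cases "k < h")
      case True
      then show ?thesis using h by (simp add: g_def)
    next
      case False
      then obtain k' where k: "k = k' + h" by (metis le_add_diff_inverse2 not_less)
      have e: "int k - N0 + n i = int k'" "int k - N0 = int k' - n i" using h k by auto
      have summand: "coeff_term i (int k' - n i) s * z ^ k = C * (f1 s * f2 (k' - s))" if "s \<le> k'" for s
      proof -
        have "z ^ k = z ^ h * (z ^ s * z ^ (k' - s))" using k that by (simp add: power_add[symmetric] add.commute)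
        moreover have "int k' = int (s + (k' - s))" using that by simp
        ultimately show ?thesis
          using coeff_term_product[OF i, of s "k' - s"]
          by (simp only: f1_def f2_def C_def power_mult_distrib mult_ac)
      qed
      have "g i k = (\<Sum>s\<le>k'. coeff_term i (int k' - n i) s * z ^ k)"
        unfolding g_def e by (simp add: sum_distrib_right)
      also have "\<dots> = C * p k'"
        unfolding p_def sum_distrib_left by (intro sum.cong summand) auto
      finally show ?thesis using k by simp
    qed
    then have g_eq: "g i = (\<lambda>k. if k < h then 0 else C * p (k - h))" by (rule ext)
    have C_eq: "C * (left_series i (W * z) * right_series i z)
        = z powi (N0 - n i) * prefactor i * left_series i (W * z) * right_series i z"
      unfolding C_def h[symmetric] by (simp only: power_int_of_nat mult.assoc)
    show ?thesis unfolding g_eq C_eq[symmetric] using d by (rule conjI)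
  qed
  have "z powi N0 * G
      = (\<Sum>i\<in>I. z powi (N0 - n i) * prefactor i * left_series i (W * z) * right_series i z)"
    unfolding G_def sum_distrib_left using assms(4)
    by (intro sum.cong) (simp_all add: power_int_diff power_int_minus field_simps)
  moreover have "(\<lambda>k. \<Sum>i\<in>I. g i k) sums
      (\<Sum>i\<in>I. z powi (N0 - n i) * prefactor i * left_series i (W * z) * right_series i z)"
    using g by (intro sums_sum) auto
  ultimately show "(\<lambda>k. coef (int k - N0) * z ^ k) sums (z powi N0 * G)"
    unfolding coef by (simp only:)
  show "summable (\<lambda>k. norm (coef (int k - N0) * z ^ k))"
    unfolding coef
  proof (rule summable_comparison_test')
    show "summable (\<lambda>k. \<Sum>i\<in>I. norm (g i k))" using g by (intro summable_sum) auto
    show "norm (norm (\<Sum>i\<in>I. g i k)) \<le> (\<Sum>i\<in>I. norm (g i k))" for k by (simp add: norm_sum)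
  qed
qed

lemma coef_eq_0:
  assumes "\<And>i. i \<in> I \<Longrightarrow> n i \<le> N0" "j < - N0"
  shows "coef j = 0"
proof -
  have "j + n i < 0" if "i \<in> I" for i using assms(1)[OF that] assms(2) by simp
  then show ?thesis by (simp add: coef_def)
qed

lemma degree_E: "degree E \<le> P + nat t"
  unfolding E_def by (rule degree_mult_qprod_poly_le)

text \<open>
  Multiplication by \<open>E\<close> replaces the coefficients by their combinations with the coefficients of \<open>E\<close>.
  These vanish beyond the upper limit \<open>P - 1 + (t)\<^sub>+ - m0\<close>, since then all indices involved are at least
  \<open>- m0\<close>, where every \<open>m\<^sub>l + j\<close> is nonnegative.
\<close>

lemma bilinear_sum_is_polynomial:
  assumes z: "norm q < 1" "norm z < 1" "norm (W * z) < 1" "z \<noteq> 0"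
    and N0: "\<And>i. i \<in> I \<Longrightarrow> n i \<le> N0" and m0: "\<And>i. i \<in> I \<Longrightarrow> m0 \<le> m i"
  shows "poly E z * (\<Sum>i\<in>I. z powi (- n i) * prefactor i * left_series i (W * z) * right_series i z)
    = (\<Sum>k = - N0..int P - 1 + int (nat t) - m0. (\<Sum>e\<le>P + nat t. coeff E e * coef (k - int e)) * z powi k)"
proof -
  define G where "G = (\<Sum>i\<in>I. z powi (- n i) * prefactor i * left_series i (W * z) * right_series i z)"
  define \<gamma> where "\<gamma> k = (\<Sum>e\<le>P + nat t. coeff E e * coef (k - int e))" for k
  define U where "U = int P - 1 + int (nat t) - m0"
  note gf = coef_generating_function[OF z N0, folded G_def]
  have fin: "(\<lambda>e. coeff E e * z ^ e) sums poly E z"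
    using sums_finite[of "{..degree E}" "\<lambda>e. coeff E e * z ^ e"]
    by (simp add: poly_altdef coeff_eq_0)
  have sumE: "summable (\<lambda>e. norm (coeff E e * z ^ e))"
    by (rule summable_finite[of "{..degree E}"]) (auto simp: coeff_eq_0)
  have "(\<lambda>k. \<Sum>e\<le>k. coeff E e * z ^ e * (coef (int (k - e) - N0) * z ^ (k - e))) sums
      (poly E z * (z powi N0 * G))"
    using Cauchy_product_sums[OF sumE gf(2)] sums_unique[OF fin] sums_unique[OF gf(1)] by simp
  also have "(\<lambda>k. \<Sum>e\<le>k. coeff E e * z ^ e * (coef (int (k - e) - N0) * z ^ (k - e)))
      = (\<lambda>k. \<gamma> (int k - N0) * z ^ k)"
  proof
    fix k
    have "(\<Sum>e\<le>k. coeff E e * z ^ e * (coef (int (k - e) - N0) * z ^ (k - e)))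
        = (\<Sum>e\<le>k. coeff E e * coef (int k - N0 - int e)) * z ^ k"
      unfolding sum_distrib_right
    proof (rule sum.cong)
      fix e assume e: "e \<in> {..k}"
      then have "z ^ k = z ^ e * z ^ (k - e)" by (simp add: power_add[symmetric])
      moreover have "int (k - e) - N0 = int k - N0 - int e" using e by (simp add: of_nat_diff)
      ultimately show "coeff E e * z ^ e * (coef (int (k - e) - N0) * z ^ (k - e))
          = coeff E e * coef (int k - N0 - int e) * z ^ k" by (simp only: mult_ac)
    qed simp
    also have "(\<Sum>e\<le>k. coeff E e * coef (int k - N0 - int e)) = \<gamma> (int k - N0)"
    proof -
      have "coeff E e = 0" if "e > P + nat t" for e using that degree_E by (intro coeff_eq_0) simp
      moreover have "coef (int k - N0 - int e) = 0" if "e > k" for e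
        using that N0 by (intro coef_eq_0) auto
      ultimately show ?thesis unfolding \<gamma>_def
        by (intro sum.mono_neutral_cong) (auto simp: not_le)
    qed
    finally show "(\<Sum>e\<le>k. coeff E e * z ^ e * (coef (int (k - e) - N0) * z ^ (k - e)))
        = \<gamma> (int k - N0) * z ^ k" .
  qed
  finally have sums: "(\<lambda>k. \<gamma> (int k - N0) * z ^ k) sums (poly E z * (z powi N0 * G))" .
  have van: "\<gamma> k = 0" if "k > U" for k
    unfolding \<gamma>_def
  proof (rule combination_of_coefs_eq_0)
    fix l assume "l \<in> I"
    then show "0 \<le> m l + (k - int (P + nat t))" using m0[of l] that by (simp add: U_def)
  qed
  define F where "F = {k. int k \<le> U + N0}"
  have "finite F" by (rule finite_subset[of _ "{..nat (U + N0)}"]) (auto simp: F_def)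
  then have "(\<lambda>k. \<gamma> (int k - N0) * z ^ k) sums (\<Sum>k\<in>F. \<gamma> (int k - N0) * z ^ k)"
    by (intro sums_finite) (auto simp: F_def van)
  with sums have "poly E z * (z powi N0 * G) = (\<Sum>k\<in>F. \<gamma> (int k - N0) * z ^ k)"
    by (rule sums_unique2)
  also have "\<dots> = (\<Sum>k = - N0..U. z powi N0 * (\<gamma> k * z powi k))"
  proof (rule sum.reindex_bij_witness[of _ "\<lambda>k. nat (k + N0)" "\<lambda>k. int k - N0"])
    fix k
    have "z ^ k = z powi N0 * z powi (int k - N0)" using z(4) by (simp add: power_int_diff)
    then show "z powi N0 * (\<gamma> (int k - N0) * z powi (int k - N0)) = \<gamma> (int k - N0) * z ^ k" by simp
  qed (auto simp: F_def)
  also have "\<dots> = z powi N0 * (\<Sum>k = - N0..U. \<gamma> k * z powi k)" by (simp add: sum_distrib_left)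
  finally have "z powi N0 * (poly E z * G) = z powi N0 * (\<Sum>k = - N0..U. \<gamma> k * z powi k)"
    by (simp only: mult_ac)
  then show ?thesis using z(4) unfolding G_def[symmetric] \<gamma>_def U_def by simp
qed

text \<open>
  Reversal of the shifted factorials with index decreasing in \<open>s\<close> gives the terms of the terminating
  series. The monomials that appear combine with \<open>W\<^sup>s\<close> to the argument \<open>q\<^bsup>N - M + r - 1 + t\<^esup>\<close> of that series.
\<close>

lemma coeff_term_reversed:
  assumes i: "i \<in> I" and s: "int s \<le> j + n i"
    and nz: "\<And>l. l \<in> I \<Longrightarrow> qpoch q (B l / A i * q powi (- m l - j)) (int s) \<noteq> 0"
  shows "coeff_term i j s = A i powi (1 - t) * (\<Prod>l\<in>I. qpoch q (q * A i / B l) (m l + j)) /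
     (qpoch q q (j + n i) * (\<Prod>l\<in>I-{i}. qpoch q (A i / A l) (n l + j + 1))) *
     (qpoch q (q powi (- j - n i)) (int s) * ((\<Prod>l\<in>I. qpoch q (B l / A i) (int s)) *
        (\<Prod>l\<in>I-{i}. qpoch q (A l / A i * q powi (- n l - j)) (int s))) /
      (((\<Prod>l\<in>I. qpoch q (B l / A i * q powi (- m l - j)) (int s)) *
        (\<Prod>l\<in>I-{i}. qpoch q (q * A l / A i) (int s))) * qpoch q q (int s)) *
      (q powi ((\<Sum>l\<in>I. n l) - (\<Sum>l\<in>I. m l) + int (card I) - 1 + t)) ^ s)"
proof -
  define e where "e = s * (s - 1) div 2"
  define X where "X l = - (B l / A i * q powi (- m l - j))" for l
  define Z where "Z l = - (A l / A i * q powi (- n l - j))" for l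
  have num: "qpoch q (q * A i / B l) (m l + j - int s)
      = X l ^ s * q ^ e * qpoch q (q * A i / B l) (m l + j) / qpoch q (B l / A i * q powi (- m l - j)) (int s)"
    if l: "l \<in> I" for l
  proof -
    have "qpoch_defined q (q * A i / B l) (m l + j - int s)"
      by (rule qpoch_defined_mono[OF num_defined[OF i l]]) (use s in simp)
    moreover have "q powi (1 - (m l + j)) / (q * A i / B l) = B l / A i * q powi (- m l - j)"
    proof -
      have "1 - (m l + j) = 1 + (- m l - j)" by simp
      then have "q powi (1 - (m l + j)) = q * q powi (- m l - j)"
        by (simp only: power_int_add[OF disjI1[OF q], of 1 "- m l - j"] power_int_1_right)
      then show ?thesis using q A[OF i] B[OF l] by simp
    qed
    ultimately show ?thesis
      using qpoch_reverse[of q "q * A i / B l" "m l + j" s] q A[OF i] B[OF l] nz[OF l]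
      by (simp add: e_def X_def field_simps)
  qed
  have den: "1 / qpoch q (A i / A l) (n l + j + 1 - int s)
      = qpoch q (A l / A i * q powi (- n l - j)) (int s) / (Z l ^ s * q ^ e * qpoch q (A i / A l) (n l + j + 1))"
    if l: "l \<in> I - {i}" for l
  proof -
    have nz: "qpoch q (A i / A l) k \<noteq> 0" for k
      using separated i l by (intro qpoch_ne_0) auto
    have d: "qpoch_defined q (A i / A l) (n l + j + 1 - int s)"
      unfolding qpoch_defined_qint using qint_ne_0[of "A i / A l" q] separated[of i l] i l by auto
    have "q powi (1 - (n l + j + 1)) / (A i / A l) = A l / A i * q powi (- n l - j)"
      by simp
    then have "qpoch q (A l / A i * q powi (- n l - j)) (int s) * qpoch q (A i / A l) (n l + j + 1 - int s)
        = Z l ^ s * q ^ e * qpoch q (A i / A l) (n l + j + 1)"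
      using qpoch_reverse[OF q _ d] A[OF i] A[of l] l by (simp add: e_def Z_def mult.commute)
    moreover have "Z l \<noteq> 0" using q A i l by (auto simp: Z_def)
    ultimately show ?thesis using nz q by (simp add: frac_eq_eq)
  qed
  have den': "1 / qpoch q q (j + n i - int s)
      = qpoch q (q powi (- j - n i)) (int s) / (Z i ^ s * q ^ e * qpoch q q (j + n i))"
  proof -
    have nz: "qpoch q q k \<noteq> 0" if "k \<ge> 0" for k
      using that by (simp add: qpoch_q_q qint_1_ne_0)
    have d: "qpoch_defined q q (j + n i - int s)" using s by (simp add: qpoch_defined_def)
    have "q powi (1 - (j + n i)) / q = q powi (- j - n i)"
    proof -
      have "1 - (j + n i) = 1 + (- j - n i)" by simp
      then have "q powi (1 - (j + n i)) = q * q powi (- j - n i)"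
        by (simp only: power_int_add[OF disjI1[OF q], of 1 "- j - n i"] power_int_1_right)
      then show ?thesis using q by simp
    qed
    moreover have "Z i = - (q powi (- j - n i))"
    proof -
      have "- n i - j = - j - n i" by simp
      then have "Z i = - (A i / A i * q powi (- j - n i))" by (simp only: Z_def)
      then show ?thesis using A[OF i] by simp
    qed
    ultimately have "qpoch q (q powi (- j - n i)) (int s) * qpoch q q (j + n i - int s)
        = Z i ^ s * q ^ e * qpoch q q (j + n i)"
      using qpoch_reverse[OF q q d] by (simp add: e_def)
    moreover have "Z i \<noteq> 0" using q A i by (auto simp: Z_def)
    ultimately show ?thesis using nz[of "j + n i - int s"] nz[of "j + n i"] s q by (simp add: frac_eq_eq)
  qed
  define a1 where "a1 = (\<Prod>l\<in>I. qpoch q (B l / A i) (int s))"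
  define a2 where "a2 = (\<Prod>l\<in>I. qpoch q (q * A i / B l) (m l + j))"
  define a3 where "a3 = (\<Prod>l\<in>I. qpoch q (B l / A i * q powi (- m l - j)) (int s))"
  define b1 where "b1 = (\<Prod>l\<in>I-{i}. qpoch q (q * A l / A i) (int s))"
  define b2 where "b2 = (\<Prod>l\<in>I-{i}. qpoch q (A i / A l) (n l + j + 1))"
  define b3 where "b3 = (\<Prod>l\<in>I-{i}. qpoch q (A l / A i * q powi (- n l - j)) (int s))"
  define XX where "XX = (\<Prod>l\<in>I. X l)"
  define ZZ where "ZZ = (\<Prod>l\<in>I-{i}. Z l)"
  have N: "(\<Prod>l\<in>I. qpoch q (B l / A i) (int s) * qpoch q (q * A i / B l) (m l + j - int s))
      = a1 * (XX ^ s * (q ^ e) ^ card I * a2 / a3)"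
    unfolding a1_def a2_def a3_def XX_def
    by (simp only: num prod.distrib prod_dividef prod_power_distrib prod_constant cong: prod.cong)
  have D: "1 / (\<Prod>l\<in>I-{i}. qpoch q (q * A l / A i) (int s) * qpoch q (A i / A l) (n l + j + 1 - int s))
      = 1 / b1 * (b3 / (ZZ ^ s * (q ^ e) ^ card (I - {i}) * b2))"
  proof -
    have "1 / (\<Prod>l\<in>I-{i}. qpoch q (q * A l / A i) (int s) * qpoch q (A i / A l) (n l + j + 1 - int s))
        = 1 / b1 * (\<Prod>l\<in>I-{i}. 1 / qpoch q (A i / A l) (n l + j + 1 - int s))"
      unfolding b1_def by (simp add: prod.distrib prod_dividef)
    then show ?thesis
      unfolding b2_def b3_def ZZ_def
      by (simp only: den prod.distrib prod_dividef prod_power_distrib prod_constant cong: prod.cong)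
  qed
  have cI: "(q ^ e) ^ card I = q ^ e * (q ^ e) ^ card (I - {i})"
    unfolding card.remove[OF I(1) i] by (simp only: power_Suc)
  have "coeff_term i j s = A i powi (1 - t) * W ^ s * (a1 * (XX ^ s * (q ^ e) ^ card I * a2 / a3))
      * (1 / qpoch q q (int s)) * (1 / qpoch q q (j + n i - int s))
      * (1 / b1 * (b3 / (ZZ ^ s * (q ^ e) ^ card (I - {i}) * b2)))"
    unfolding coeff_term_def N D[symmetric] by simp
  also have "\<dots> = A i powi (1 - t) * a2 / (qpoch q q (j + n i) * b2)
      * (qpoch q (q powi (- j - n i)) (int s) * (a1 * b3) / ((a3 * b1) * qpoch q q (int s)))
      * (W ^ s * XX ^ s / (Z i ^ s * ZZ ^ s))"
    unfolding den' cI using q by (simp add: mult_ac)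
  also have "W ^ s * XX ^ s / (Z i ^ s * ZZ ^ s) = (W * XX / (Z i * ZZ)) ^ s"
    by (simp add: power_divide power_mult_distrib)
  also have "W * XX / (Z i * ZZ) = q powi ((\<Sum>l\<in>I. n l) - (\<Sum>l\<in>I. m l) + int (card I) - 1 + t)"
  proof -
    have pp: "(\<Prod>l\<in>F. q powi f l) = q powi (\<Sum>l\<in>F. f l)" if "finite F" for F and f :: "'i \<Rightarrow> int"
      using that by induction (use q in \<open>simp_all add: power_int_add\<close>)
    have ZI: "Z i * ZZ = (\<Prod>l\<in>I. Z l)" unfolding ZZ_def using prod.remove[OF I(1) i] by metis
    have "X l / Z l = B l / A l * q powi (n l - m l)" if "l \<in> I" for l
    proof -
      have "n l - m l = (- m l - j) - (- n l - j)" by simp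
      then have "q powi (n l - m l) = q powi (- m l - j) / q powi (- n l - j)"
        using power_int_diff[OF disjI1[OF q], of "- m l - j" "- n l - j"] by simp
      then show ?thesis unfolding X_def Z_def using A[OF i] A[OF that] q by simp
    qed
    then have ratio: "XX / (Z i * ZZ) = (\<Prod>l\<in>I. B l / A l) * q powi (\<Sum>l\<in>I. n l - m l)"
      unfolding XX_def ZI prod_dividef[symmetric] using pp[OF I(1), of "\<lambda>l. n l - m l"]
      by (simp only: prod.distrib cong: prod.cong)
    have cancel: "(\<Prod>l\<in>I. A l / B l) * (\<Prod>l\<in>I. B l / A l) = 1"
      using A B by (simp add: prod.distrib[symmetric])
    have "W * XX / (Z i * ZZ) = W * (XX / (Z i * ZZ))" by simp
    also have "\<dots> = q powi (t + int (card I) - 1) * q powi (\<Sum>l\<in>I. n l - m l)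
        * ((\<Prod>l\<in>I. A l / B l) * (\<Prod>l\<in>I. B l / A l))"
      unfolding ratio W_def by (simp only: mult_ac)
    also have "\<dots> = q powi (t + int (card I) - 1) * q powi (\<Sum>l\<in>I. n l - m l)"
      unfolding cancel by simp
    also have "\<dots> = q powi ((t + int (card I) - 1) + (\<Sum>l\<in>I. n l - m l))"
      by (rule power_int_add[OF disjI1[OF q], symmetric])
    also have "(t + int (card I) - 1) + (\<Sum>l\<in>I. n l - m l) = (\<Sum>l\<in>I. n l) - (\<Sum>l\<in>I. m l) + int (card I) - 1 + t"
      by (simp add: sum_subtractf)
    finally show ?thesis .
  qed
  finally show ?thesis
    unfolding a1_def a2_def a3_def b1_def b2_def b3_def by (simp only: mult.assoc)
qed

end

section \<open>The series of the theorem\<close>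

lemma qexp_add: "qexp L (x + y) = qexp L x * qexp L y"
  by (simp add: qexp_def distrib_right exp_add)

lemma qexp_diff: "qexp L (x - y) = qexp L x / qexp L y"
  by (simp add: qexp_def left_diff_distrib exp_diff)

lemma qexp_ne_0: "qexp L x \<noteq> 0"
  by (simp add: qexp_def)

lemma qexp_mult_of_int: "qexp L (x * of_int k) = qexp L x powi k"
  by (simp add: qexp_def exp_power_int mult_ac)

lemma qexp_of_int: "exp L = q \<Longrightarrow> qexp L (of_int k) = q powi k"
  using qexp_mult_of_int[of L 1 k] by (simp add: qexp_def)

lemma qexp_minus: "qexp L (- x) = 1 / qexp L x"
  using qexp_diff[of L 0 x] by (simp add: qexp_def)

lemma qexp_1: "exp L = q \<Longrightarrow> qexp L 1 = q"
  by (simp add: qexp_def)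

lemma prod_list_map_range: "(\<Prod>c\<leftarrow>map f [1..<r + 1]. g c) = (\<Prod>l=1..r. g (f l))"
proof -
  have "set [1..<r + 1] = {1..r}" by auto
  then show ?thesis
    using prod.distinct_set_conv_list[of "[1..<r + 1]" "\<lambda>l. g (f l)"]
    by (simp add: comp_def del: set_upt upt_Suc)
qed

lemma prod_list_map_others: "(\<Prod>c\<leftarrow>map f (others r i). g c) = (\<Prod>l\<in>{1..r} - {i}. g (f l))"
proof -
  have "set (others r i) = {1..r} - {i}" by (auto simp: others_def)
  moreover have "distinct (others r i)" by (simp add: others_def)
  ultimately show ?thesis
    using prod.distinct_set_conv_list[of "others r i" "\<lambda>l. g (f l)"] by (simp add: comp_def)
qed

lemma length_others: "i \<in> {1..r} \<Longrightarrow> length (others r i) = r - 1"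
proof -
  assume i: "i \<in> {1..r}"
  have "length (others r i) = card (set (others r i))"
    by (rule distinct_card[symmetric]) (simp add: others_def)
  also have "set (others r i) = {1..r} - {i}" by (auto simp: others_def)
  finally show ?thesis using i by simp
qed

lemma basic_hyp_balanced:
  assumes "i \<in> {1..r}"
  shows "basic_hyp q (map c [1..<r + 1]) (map d (others r i)) z =
    (\<Sum>s. (\<Prod>l=1..r. qpoch q (c l) (int s)) /
      ((\<Prod>l\<in>{1..r}-{i}. qpoch q (d l) (int s)) * qpoch q q (int s)) * z ^ s)"
proof -
  have len: "1 + length (map d (others r i)) - length (map c [1..<r + 1]) = 0"
    using length_others[OF assms] assms by simp
  show ?thesis
    unfolding basic_hyp_def len prod_list_map_range prod_list_map_others by simp
qed

lemma basic_hyp_terminating: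
  assumes i: "i \<in> {1..r}" and K: "\<forall>s>K. qpoch q c0 (int s) = 0"
  shows "basic_hyp q (c0 # map c [1..<r + 1] @ map c' (others r i)) (map d [1..<r + 1] @ map d' (others r i)) z =
    (\<Sum>s\<le>K. qpoch q c0 (int s) * ((\<Prod>l=1..r. qpoch q (c l) (int s)) * (\<Prod>l\<in>{1..r}-{i}. qpoch q (c' l) (int s))) /
      (((\<Prod>l=1..r. qpoch q (d l) (int s)) * (\<Prod>l\<in>{1..r}-{i}. qpoch q (d' l) (int s))) * qpoch q q (int s)) * z ^ s)"
proof -
  have len: "1 + length (map d [1..<r + 1] @ map d' (others r i))
      - length (c0 # map c [1..<r + 1] @ map c' (others r i)) = 0"
    using i by simp
  have "basic_hyp q (c0 # map c [1..<r + 1] @ map c' (others r i)) (map d [1..<r + 1] @ map d' (others r i)) z =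
    (\<Sum>s. qpoch q c0 (int s) * ((\<Prod>l=1..r. qpoch q (c l) (int s)) * (\<Prod>l\<in>{1..r}-{i}. qpoch q (c' l) (int s))) /
      (((\<Prod>l=1..r. qpoch q (d l) (int s)) * (\<Prod>l\<in>{1..r}-{i}. qpoch q (d' l) (int s))) * qpoch q q (int s)) * z ^ s)"
    unfolding basic_hyp_def len
    by (simp only: list.map map_append prod_list.Cons prod_list.append prod_list_map_range prod_list_map_others
        power_0 mult_1_right)
  also have "\<dots> = (\<Sum>s\<le>K. qpoch q c0 (int s) * ((\<Prod>l=1..r. qpoch q (c l) (int s)) * (\<Prod>l\<in>{1..r}-{i}. qpoch q (c' l) (int s))) /
      (((\<Prod>l=1..r. qpoch q (d l) (int s)) * (\<Prod>l\<in>{1..r}-{i}. qpoch q (d' l) (int s))) * qpoch q q (int s)) * z ^ s)"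
    by (rule suminf_finite) (auto simp: K not_le)
  finally show ?thesis .
qed

lemma qpoch_terminates:
  assumes "q \<noteq> 0" "int s > k" "0 \<le> k"
  shows "qpoch q (q powi (- k)) (int s) = 0"
proof -
  have "1 - q powi (- k) * q ^ nat k = 0"
    using assms by (simp add: power_int_def power_inverse)
  moreover have "nat k \<in> {..<s}" using assms by auto
  ultimately show ?thesis unfolding qpoch_nonneg by (intro prod_zero) blast+
qed

lemma half_sum_triangles: "(h * (h - 1) + g * (g - 1)) div 2 = h * (h - 1) div 2 + g * (g - 1) div (2::nat)"
proof -
  have "even (h * (h - 1))" by (cases h) auto
  then show ?thesis by (rule div_plus_div_distrib_dvd_left)
qed

lemma not_root_of_unity:
  fixes q :: complex
  assumes "norm q < 1"
  shows "q ^ Suc k \<noteq> 1"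
proof
  assume "q ^ Suc k = 1"
  then have "norm q ^ Suc k = 1" by (metis norm_one norm_power)
  then show False using assms power_less_one_iff[of "norm q" "Suc k"] by simp
qed

context nonterminating_data
begin

text \<open>
  With \<^term>\<open>P\<close> for \<open>p + 1\<close> this is the inner sum of \<^const>\<open>beta\<close>, including its sign.
\<close>

lemma coeff_E:
  "coeff E e = (-1) ^ e * (\<Sum>(g, h)\<in>{(g :: nat, h :: nat). g + h = e}.
     qbinom q P h * qbinom q (nat t) g * q ^ ((h * (h - 1) + g * (g - 1)) div 2) * W ^ h)"
proof -
  have "coeff E e = (\<Sum>h\<le>e. coeff (qprod_poly q W P) h * coeff (qprod_poly q 1 (nat t)) (e - h))"
    unfolding E_def by (rule coeff_mult)
  also have "\<dots> = (\<Sum>(g, h)\<in>{(g, h). g + h = e}. coeff (qprod_poly q W P) h * coeff (qprod_poly q 1 (nat t)) g)"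
    by (rule sum.reindex_bij_witness[of _ snd "\<lambda>h. (e - h, h)"]) auto
  also have "\<dots> = (\<Sum>(g, h)\<in>{(g, h). g + h = e}. (-1) ^ e *
      (qbinom q P h * qbinom q (nat t) g * q ^ ((h * (h - 1) + g * (g - 1)) div 2) * W ^ h))"
  proof (rule sum.cong, rule refl, clarify)
    fix g h :: nat
    show "coeff (qprod_poly q W P) h * coeff (qprod_poly q 1 (nat t)) g = (-1) ^ (g + h) *
      (qbinom q P h * qbinom q (nat t) g * q ^ ((h * (h - 1) + g * (g - 1)) div 2) * W ^ h)"
      by (simp only: coeff_qprod_poly[OF nru] half_sum_triangles power_add power_one mult_1_left mult_1_right mult_ac)
  qed
  finally show ?thesis by (simp add: sum_distrib_left case_prod_unfold)
qed

end

theorem theorem1: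
  fixes r :: nat and q L z :: complex
    and a b :: "nat \<Rightarrow> complex" and m n :: "nat \<Rightarrow> int" and t :: int
  assumes "r \<ge> 2"
    and "0 < norm q" and "norm q < 1" and "exp L = q"
    and "\<And>i j. 1 \<le> i \<Longrightarrow> i < j \<Longrightarrow> j \<le> r \<Longrightarrow> a i - a j \<notin> \<int>"
    and "z \<noteq> 0" and "norm z < 1" and "norm (W_par L r a b t * z) < 1"
    and "lhs_defined q L r a b m n"
    and "\<And>j. j \<in> {- n_max r n..p_par r m n t + max 0 t - m_min r m}
           \<Longrightarrow> alpha_defined q L r a b m n j"
  shows "lhs q L r a b m n t z =
     1 / (qpoch q (W_par L r a b t * z) (p_par r m n t + 1) * qpoch q z (max 0 t)) *
     (\<Sum>k = - n_max r n..p_par r m n t + max 0 t - m_min r m.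
        beta q L r a b m n t k * z powi k)"
proof -
  define A where "A i = qexp L (a i)" for i
  define B where "B i = qexp L (b i)" for i
  have q: "q \<noteq> 0" using assms(2) by auto
  note qi = qexp_of_int[OF assms(4)] qexp_1[OF assms(4)]
  have A0: "A i \<noteq> 0" and B0: "B i \<noteq> 0" for i by (simp_all add: A_def B_def qexp_ne_0)
  have args: "qexp L (1 - b l + a i) = q * A i / B l" "qexp L (a i - a l) = A i / A l"
    "qexp L (b l - a i) = B l / A i" "qexp L (1 + a l - a i) = q * A l / A i"
    "qexp L (1 - a i + a l) = q * A l / A i"
    "qexp L (1 - b l + a i + of_int (m l) - of_int (n i)) = q * A i / B l * q powi (m l - n i)"
    "qexp L (1 - a l + a i + of_int (n l) - of_int (n i)) = A i / A l * q powi (n l - n i + 1)"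
    "qexp L (of_int (- j - n i)) = q powi (- j - n i)"
    "qexp L (a l - a i - of_int (n l) - of_int j) = A l / A i * q powi (- n l - j)"
    "qexp L (b l - a i - of_int (m l) - of_int j) = B l / A i * q powi (- m l - j)"
    for i l j
    using q by (simp_all only: qexp_add qexp_diff qexp_minus qi A_def B_def of_int_diff of_int_minus)
      (simp_all add: power_int_add power_int_diff power_int_minus field_simps)
  have ldef: "qpoch_defined q (q * A i / B l) (m l - n i)" if "i \<in> {1..r}" "l \<in> {1..r}" for i l
    using assms(9) that unfolding lhs_defined_def args by blast
  \<comment> \<open>The nodes are separated because the denominators on the left-hand side do not vanish: those of the first series exclude all \<open>k \<noteq> 0\<close>, those of the prefactor exclude \<open>k = 0\<close>.\<close>
  have sep: "A l / A i * q powi k \<noteq> 1" if "i \<in> {1..r}" "l \<in> {1..r}" "l \<noteq> i" "k \<ge> 1" for i l and k :: int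
  proof
    assume *: "A l / A i * q powi k = 1"
    have "q powi k = q * q ^ nat (k - 1)"
      using that q by (simp add: power_int_def nat_diff_distrib flip: power_Suc)
    then have "1 - q * A l / A i * q ^ nat (k - 1) = 0" using * by (simp add: mult_ac)
    then have "qpoch q (q * A l / A i) (int (nat k)) = 0"
      unfolding qpoch_nonneg using that by (intro prod_zero bexI[of _ "nat (k - 1)"]) auto
    then show False using assms(9) that unfolding lhs_defined_def args by blast
  qed
  have ne: "A i \<noteq> A l" if "i \<in> {1..r}" "l \<in> {1..r}" "l \<noteq> i" "n i \<le> n l" for i l
  proof
    assume "A i = A l"
    then have "qpoch q (A i / A l) (n l - n i + 1) = 0"
      using that A0 unfolding qpoch_def by (auto intro!: prod_zero bexI[of _ 0])
    then show False using assms(9) that unfolding lhs_defined_def args by blast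
  qed
  interpret nonterminating_data q "{1..r}" A B m n t
  proof
    show "q ^ Suc k \<noteq> 1" for k using not_root_of_unity[OF assms(3)] .
    show "{1..r} \<noteq> {}" using assms(1) by simp
    show "A i / A l * q powi k \<noteq> 1" if il: "i \<in> {1..r}" "l \<in> {1..r}" "l \<noteq> i" for i l k
    proof (cases "k = 0")
      case True
      then show ?thesis using ne[of i l] ne[of l i] il A0[of l] by (cases "n i \<le> n l") auto
    next
      case False
      show ?thesis
      proof (cases "k \<ge> 1")
        case True
        then show ?thesis using sep[of l i k] il by simp
      next
        case k: False
        have "A l / A i * q powi (- k) = inverse (A i / A l * q powi k)"
          by (simp add: power_int_minus divide_inverse)
        then show ?thesis using sep[of i l "- k"] il k False by auto
      qed
    qed
  qed (use q A0 B0 ldef in auto)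
  have Wp: "W_par L r a b t = W"
    unfolding W_par_def W_def qi(1) by (simp add: qexp_diff A_def B_def)
  have Pp: "p_par r m n t + 1 = int P" unfolding p_par_def P_def by simp
  have tp: "max 0 t = int (nat t)" by simp
  have N0: "n i \<le> n_max r n" if "i \<in> {1..r}" for i
    unfolding n_max_def using that by (intro Max_ge) auto
  have m0: "m_min r m \<le> m i" if "i \<in> {1..r}" for i
    unfolding m_min_def using that by (intro Min_le) auto
  have pw: "qexp L (a i * (1 - of_int t)) = A i powi (1 - t)" for i
    using qexp_mult_of_int[of L "a i" "1 - t"] by (simp add: A_def)
  have lhs: "lhs q L r a b m n t z =
      (\<Sum>i=1..r. z powi (- n i) * prefactor i * left_series i (W * z) * right_series i z)"
    unfolding lhs_def
  proof (rule sum.cong)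
    fix i assume i: "i \<in> {1..r}"
    show "qexp L (a i * (1 - of_int t)) *
        (z powi (- n i) * (\<Prod>l=1..r. qpoch q (qexp L (1 - b l + a i)) (m l - n i))
          / (\<Prod>l\<in>{1..r} - {i}. qpoch q (qexp L (a i - a l)) (n l - n i + 1))) *
        basic_hyp q
          (map (\<lambda>l. qexp L (b l - a i)) [1..<r+1])
          (map (\<lambda>l. qexp L (1 + a l - a i)) (others r i))
          (W_par L r a b t * z) *
        basic_hyp q
          (map (\<lambda>l. qexp L (1 - b l + a i + of_int (m l) - of_int (n i))) [1..<r+1])
          (map (\<lambda>l. qexp L (1 - a l + a i + of_int (n l) - of_int (n i))) (others r i))
          z = z powi (- n i) * prefactor i * left_series i (W * z) * right_series i z"
      unfolding basic_hyp_balanced[OF i] args Wp pw left_series_def right_series_def prefactor_def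
      by simp
  qed simp
  have alpha: "alpha q L r a b m n t j = coef j" if def: "alpha_defined q L r a b m n j" for j
    unfolding alpha_def coef_def
  proof (rule sum.cong, simp, rule if_cong, simp, simp)
    fix i assume i: "i \<in> {1..r}" and "\<not> j + n i < 0"
    then have j: "j + n i \<ge> 0" by simp
    have K: "\<forall>s>nat (j + n i). qpoch q (q powi (- j - n i)) (int s) = 0"
      using qpoch_terminates[OF q, of "j + n i"] j by (simp add: algebra_simps)
    have card: "(\<Sum>i=1..r. n i) - (\<Sum>i=1..r. m i) + int r - 1 + t
        = (\<Sum>i=1..r. n i) - (\<Sum>i=1..r. m i) + int (card {1..r}) - 1 + t" by simp
    have "qpoch q (B l / A i * q powi (- m l - j)) (int s) \<noteq> 0"
      if "l \<in> {1..r}" "int s \<le> j + n i" for l s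
      using def that i j unfolding alpha_defined_def args by blast
    then show "qexp L (a i * (1 - of_int t)) * (\<Prod>l=1..r. qpoch q (qexp L (1 - b l + a i)) (m l + j))
        / (qpoch q q (j + n i)
             * (\<Prod>l\<in>{1..r} - {i}. qpoch q (qexp L (a i - a l)) (n l + j + 1)))
        * basic_hyp q
            (qexp L (of_int (- j - n i)) #
               map (\<lambda>l. qexp L (b l - a i)) [1..<r+1] @
               map (\<lambda>l. qexp L (a l - a i - of_int (n l) - of_int j)) (others r i))
            (map (\<lambda>l. qexp L (b l - a i - of_int (m l) - of_int j)) [1..<r+1] @
               map (\<lambda>l. qexp L (1 - a i + a l)) (others r i))
            (qexp L (of_int ((\<Sum>i=1..r. n i) - (\<Sum>i=1..r. m i) + int r - 1 + t)))
        = (\<Sum>s\<le>nat (j + n i). coeff_term i j s)"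
      unfolding args pw qi(1) card basic_hyp_terminating[OF i K] sum_distrib_left
      by (intro sum.cong refl coeff_term_reversed[symmetric] i) (use j in auto)
  qed
  have beta: "beta q L r a b m n t k = (\<Sum>e\<le>P + nat t. coeff E e * coef (k - int e))"
    if k: "k \<in> {- n_max r n..p_par r m n t + max 0 t - m_min r m}" for k
  proof -
    have "beta q L r a b m n t k =
      (\<Sum>j = max (- n_max r n) (k - int (P + nat t))..k. coeff E (nat (k - j)) * coef j)"
      unfolding beta_def Let_def
    proof (rule sum.cong)
      show "{max (- n_max r n) (k - p_par r m n t - max 0 t - 1)..k}
          = {max (- n_max r n) (k - int (P + nat t))..k}"
      proof -
        have "k - p_par r m n t - max 0 t - 1 = k - int (P + nat t)" using Pp by simp
        then show ?thesis by (simp only:)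
      qed
    next
      fix j assume j: "j \<in> {max (- n_max r n) (k - int (P + nat t))..k}"
      then have "alpha q L r a b m n t j = coef j"
        using k by (intro alpha assms(10)) auto
      moreover have "{(g, h). int g + int h = k - j} = {(g, h). g + h = nat (k - j)}"
        using j by auto
      moreover have "nat (p_par r m n t + 1) = P" "nat (max 0 t) = nat t" using Pp by auto
      ultimately show "(-1) ^ nat (k - j) * alpha q L r a b m n t j *
        (\<Sum>(g, h)\<in>{(g :: nat, h :: nat). int g + int h = k - j}.
           qbinom q (nat (p_par r m n t + 1)) h * qbinom q (nat (max 0 t)) g
           * q ^ ((h * (h - 1) + g * (g - 1)) div 2) * W_par L r a b t ^ h)
          = coeff E (nat (k - j)) * coef j"
        unfolding coeff_E Wp by (simp only: mult_ac)
    qed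
    \<comment> \<open>The indices \<open>k - e < - n_max r n\<close> that are missing here have \<open>coef (k - e) = 0\<close>.\<close>
    also have "\<dots> = (\<Sum>e | e \<le> P + nat t \<and> - n_max r n \<le> k - int e. coeff E e * coef (k - int e))"
      by (rule sum.reindex_bij_witness[of _ "\<lambda>e. k - int e" "\<lambda>j. nat (k - j)"])
         (auto split: if_splits)
    also have "\<dots> = (\<Sum>e\<le>P + nat t. coeff E e * coef (k - int e))"
    proof (rule sum.mono_neutral_left)
      show "\<forall>e\<in>{..P + nat t} - {e. e \<le> P + nat t \<and> - n_max r n \<le> k - int e}.
          coeff E e * coef (k - int e) = 0"
      proof
        fix e assume "e \<in> {..P + nat t} - {e. e \<le> P + nat t \<and> - n_max r n \<le> k - int e}"
        then have "k - int e < - n_max r n" by auto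
        then have "coef (k - int e) = 0" using N0 by (intro coef_eq_0)
        then show "coeff E e * coef (k - int e) = 0" by simp
      qed
    qed auto
    finally show ?thesis .
  qed
  have Wz: "norm (W * z) < 1" using assms(8) by (simp add: Wp)
  have Ez: "qpoch q (W_par L r a b t * z) (p_par r m n t + 1) * qpoch q z (max 0 t) = poly E z"
    unfolding Pp tp Wp qpoch_nonneg E_def poly_mult poly_qprod_poly by (simp add: mult.commute)
  have nz: "y * q ^ k \<noteq> 1" if "norm y < 1" for y k
  proof
    assume "y * q ^ k = 1"
    then have "norm y * norm q ^ k = 1" by (metis norm_mult norm_one norm_power)
    moreover have "norm y * norm q ^ k \<le> norm y * 1"
      using assms(3) by (intro mult_left_mono power_le_one) auto
    ultimately show False using that by simp
  qed
  have E0: "poly E z \<noteq> 0"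
    unfolding E_def poly_mult poly_qprod_poly using nz[OF Wz] nz[OF assms(7)]
    by (auto simp: mult.commute)
  have range: "p_par r m n t + max 0 t - m_min r m = int P - 1 + int (nat t) - m_min r m"
    using Pp by simp
  have "poly E z * lhs q L r a b m n t z =
      (\<Sum>k = - n_max r n..p_par r m n t + max 0 t - m_min r m. beta q L r a b m n t k * z powi k)"
    unfolding lhs using bilinear_sum_is_polynomial[OF assms(3,7) Wz assms(6) N0 m0] beta
    by (simp add: range)
  then show ?thesis unfolding Ez using E0 by (simp add: field_simps)
qed

end
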